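(* Let $f:\mathbb{R}^d\to\mathbb{R}$ be continuously differentiable with Lipschitz continuous gradient with constant $L_1>0$, i.e. $\|\nabla f(z_1)-\nabla f(z_2)\|_*\le L_1\|z_1-z_2\|$ for all $z_1,z_2\in\mathbb{R}^d$, where $B=\lambda\mathbf{I}$ with $\lambda>0$. Let $\mu>0$ and let $\sigma\ge 0$ satisfy $E_u[\|G_\mu(z;u)-F_\mu(z)\|_*^2]\le\sigma^2$ for all $z\in\mathbb{R}^d$. Suppose that for some $\rho\in[0,\frac{1}{8L_1})$ there is $z^*\in\mathbb{R}^d$ such that $\langle F(z),z-z^*\rangle+\frac{\rho}{2}\|F(z)\|_*^2\ge 0$ for all $z\in\mathbb{R}^d$. Let $\{z_k\},\{\hat z_k\}$ be generated by the zeroth-order extragradient algorithm (ZO-EG, unconstrained) with constant step sizes $h_1,h_2>0$ satisfying $h_1\le\frac{1}{L_1\lambda}$ and $h_2\in\left(\sqrt{\frac{2\rho}{L_1\lambda^2}},\frac{h_1}{2}\right]$. Let $r_0=|z_0-z^*|$ and let $\epsilon>0$. If $$\mu\le\min\left\{\frac{\epsilon}{\sqrt{2}\,\lambda L_1(d+3)^{3/2}},\ \left(\frac{\lambda^2L_1h_2^2-2\rho}{16\lambda L_1d+16\lambda L_1^2\rho(d+3)^3}\right)^{1/2}\epsilon\right\}\quad\text{and}\quad N\ge\left\lceil\left(\frac{8\lambda^2L_1r_0^2}{\lambda^2L_1h_2^2-2\rho}\right)\epsilon^{-2}-1\right\rceil,$$ then $$\frac{1}{N+1}\sum_{k=0}^{N}E_{\mathcal{U}_k}[|F(\hat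 z_k)|^2]\le\epsilon^2+\frac{6\lambda\sigma^2}{\lambda^2L_1^2h_2^2-2\rho L_1}.$$
   Context: $n,m\in\mathbb{N}$, $d=n+m$, points $z=(x,y)\in\mathbb{R}^n\times\mathbb{R}^m=\mathbb{R}^d$. $B=\lambda\mathbf{I}$ with $\lambda>0$. $\langle\cdot,\cdot\rangle$ is the Euclidean inner product, $|z|=\langle z,z\rangle^{1/2}$, $\|z\|=\langle z,Bz\rangle^{1/2}=\sqrt{\lambda}|z|$, $\|z\|_*=\langle z,B^{-1}z\rangle^{1/2}=|z|/\sqrt{\lambda}$. $F(z)=(\nabla_x f(z),-\nabla_y f(z))$. For $\mu>0$ the Gaussian smoothing of $f$ is $f_\mu(z)=E_u[f(z+\mu u)]$ with $u\sim\mathcal{N}(0,B^{-1})$, and $F_\mu(z)=(\nabla_x f_\mu(z),-\nabla_y f_\mu(z))$. For $u=(u_1,u_2)\in\mathbb{R}^n\times\mathbb{R}^m$ the random oracle is $G_\mu(z;u)=\frac{f(z+\mu u)-f(z)}{\mu}\,(\lambda u_1,-\lambda u_2)$. ZO-EG (unconstrained): given $z_0\in\mathbb{R}^d$, for $k=0,1,\dots,N$: sample $\hat u_k\sim\mathcal{N}(0,B^{-1})$ and set $\hat z_k=z_k-h_1G_\mu(z_k;\hat u_k)$; sample $u_k\sim\mathcal{N}(0,B^{-1})$ and set $z_{k+1}=z_k-h_2G_\mu(\hat z_k;u_k)$. All sampled vectors are independent. $\mathcal{U}_k=[(u_0,\hat u_0),\dots,(u_k,\hat u_k)]$ and $E_{\mathcal{U}_k}$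 is expectation over $\mathcal{U}_k$. *)

theory Defs
  imports "HOL-Probability.Probability"
begin

definition grad :: "('a::real_inner \<Rightarrow> real) \<Rightarrow> 'a \<Rightarrow> 'a" where
  "grad f x = (THE g. GDERIV f x :> g)"

lemma grad_eqI:
  assumes "GDERIV f x :> g"
  shows "grad f x = g"
  unfolding grad_def
proof (rule the_equality)
  show "GDERIV f x :> g" by (fact assms)
next
  fix g' assume "GDERIV f x :> g'"
  then have "(\<lambda>h. inner h g') = (\<lambda>h. inner h g)"
    using assms unfolding gderiv_def by (rule has_derivative_unique)
  then have "inner h (g' - g) = 0" for h
    by (simp add: inner_diff_right fun_eq_iff)
  from this[of "g' - g"] show "g' = g" by simp
qed

(* The weight matrix is B = lam I throughout, so B z is lam *\<^sub>R z and B^{-1} z is inverse lam *\<^sub>R z. *)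
definition normB :: "real \<Rightarrow> 'a::real_inner \<Rightarrow> real" where
  "normB lam z = sqrt (inner z (lam *\<^sub>R z))"

definition normB_dual :: "real \<Rightarrow> 'a::real_inner \<Rightarrow> real" where
  "normB_dual lam z = sqrt (inner z (inverse lam *\<^sub>R z))"

(* Density and law of N(0, B^{-1}): the coordinates are independent
   N(0, 1/lam); the second argument of normal_density is the standard deviation. *)
definition gauss_density :: "real \<Rightarrow> 'a::euclidean_space \<Rightarrow> real" where
  "gauss_density lam u = (\<Prod>b\<in>Basis. normal_density 0 (1 / sqrt lam) (inner u b))"

definition gauss :: "real \<Rightarrow> 'a::euclidean_space measure" where
  "gauss lam = density lborel (\<lambda>u. ennreal (gauss_density lam u))"

definition smoothing :: "real \<Rightarrow> real \<Rightarrow> ('a::euclidean_space \<Rightarrow> real) \<Rightarrow> 'a \<Rightarrow> real" where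
  "smoothing lam \<mu> f z = (\<integral>u. f (z + \<mu> *\<^sub>R u) \<partial>gauss lam)"

definition saddle_op ::
  "('a::real_inner \<times> 'b::real_inner \<Rightarrow> real) \<Rightarrow> 'a \<times> 'b \<Rightarrow> 'a \<times> 'b" where
  "saddle_op f z =
     (grad (\<lambda>x. f (x, snd z)) (fst z), - grad (\<lambda>y. f (fst z, y)) (snd z))"

definition zo_oracle ::
  "real \<Rightarrow> real \<Rightarrow> ('a::real_inner \<times> 'b::real_inner \<Rightarrow> real) \<Rightarrow> 'a \<times> 'b \<Rightarrow> 'a \<times> 'b \<Rightarrow> 'a \<times> 'b"
where
  "zo_oracle lam \<mu> f z u =
     ((f (z + \<mu> *\<^sub>R u) - f z) / \<mu>) *\<^sub>R (lam *\<^sub>R fst u, - (lam *\<^sub>R snd u))"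

end

theory Submission
  imports Defs
begin

text \<open>Let \<open>m z\<close> be the mean of the oracle at \<open>z\<close>. Gaussian integration by parts identifies it with the
  Gaussian average of \<open>F (z + \<mu> u)\<close>, so \<open>m\<close> is Lipschitz with the constant of \<open>F\<close>, lies within
  \<open>L \<mu> sqrt (d / lam)\<close> of \<open>F\<close>, and inherits the weak Minty inequality up to an error of order \<open>\<mu>\<^sup>2 d\<close>.
  The mean square deviation of the oracle is smallest about its mean, so the hypothesis on the deviation from
  \<open>F\<^sub>\<mu>\<close> also bounds the variance about \<open>m\<close>; nothing else about \<open>F\<^sub>\<mu>\<close> is needed.

  In one iteration, expanding \<open>|z\<^sub>k\<^sub>+\<^sub>1 - z\<^sup>*|\<^sup>2\<close> and using the weak Minty inequality at the extrapolated
  point together with \<open>L h1 \<le> 1\<close> gives an expected decrease of \<open>c |m (zhat\<^sub>k)|\<^sup>2\<close>, where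
  \<open>c = h1 h2 - h2\<^sup>2 - h2 \<rho> / lam\<close>, up to a constant error; telescoping yields the claim.\<close>

section \<open>Gaussian integration by parts\<close>

text \<open>The coordinate product collapses because the squared coordinates sum to the squared
  norm. The radial form makes densities with different \<open>lam\<close> comparable and easy to
  differentiate along lines.\<close>

lemma gauss_density_eq:
  fixes u :: "'a::euclidean_space"
  assumes "lam > 0"
  shows "gauss_density lam u = (1 / sqrt (2 * pi / lam)) ^ DIM('a) * exp (- (lam / 2) * (norm u)\<^sup>2)"
proof -
  have "gauss_density lam u = (\<Prod>b\<in>(Basis::'a set). 1 / sqrt (2 * pi / lam) * exp (- (lam / 2) * (inner u b)\<^sup>2))"
    unfolding gauss_density_def normal_density_def
    using assms by (intro prod.cong) (auto simp: power_divide field_simps)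
  also have "\<dots> = (1 / sqrt (2 * pi / lam)) ^ DIM('a) * exp (\<Sum>b\<in>(Basis::'a set). - (lam / 2) * (inner u b)\<^sup>2)"
    by (simp only: prod.distrib prod_constant exp_sum[OF finite_Basis])
  also have "(\<Sum>b\<in>(Basis::'a set). - (lam / 2) * (inner u b)\<^sup>2) = - (lam / 2) * (norm u)\<^sup>2"
    unfolding sum_distrib_left[symmetric] power2_norm_eq_inner
    by (subst (2) euclidean_inner) (simp add: power2_eq_square)
  finally show ?thesis .
qed

lemma gauss_density_nonneg: "0 \<le> gauss_density lam u"
  by (auto simp: gauss_density_def intro!: prod_nonneg)

lemma gauss_density_measurable [measurable]: "gauss_density lam \<in> borel_measurable borel"
  unfolding gauss_density_def by measurable

lemma sets_gauss [measurable_cong, simp]: "sets (gauss lam) = sets borel"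
  and space_gauss [simp]: "space (gauss lam) = UNIV"
  by (simp_all add: gauss_def)

lemma prob_space_gauss:
  assumes "lam > 0"
  shows "prob_space (gauss lam :: 'a::euclidean_space measure)"
proof
  have "emeasure (gauss lam :: 'a measure) (space (gauss lam))
      = (\<integral>\<^sup>+u. (\<Prod>b\<in>(Basis::'a set). ennreal (normal_density 0 (1 / sqrt lam) (inner u b))) \<partial>lborel)"
    by (simp add: gauss_def emeasure_density gauss_density_def prod_ennreal)
  also have "\<dots> = (\<Prod>b\<in>(Basis::'a set). (\<integral>\<^sup>+x. ennreal (normal_density 0 (1 / sqrt lam) x) \<partial>lborel))"
    by (subst nn_integral_lborel_prod) auto
  also have "(\<integral>\<^sup>+x. ennreal (normal_density 0 (1 / sqrt lam) x) \<partial>lborel) = 1"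
    using assms by (subst nn_integral_eq_integral) auto
  finally show "emeasure (gauss lam :: 'a measure) (space (gauss lam)) = 1" by simp
qed

section \<open>Functions of polynomial growth and their Gaussian integrability\<close>

text \<open>A class closed under the algebraic operations whose measurable members are integrable
  against every Gaussian, so integrability goals reduce to introduction rules. The base
  \<open>1 + norm u\<close> is at least 1, so exponents may be raised freely when two bounds are
  merged.\<close>

definition poly_growth :: "('a::real_normed_vector \<Rightarrow> 'b::real_normed_vector) \<Rightarrow> bool" where
  "poly_growth h \<longleftrightarrow> (\<exists>C k. C \<ge> 0 \<and> (\<forall>u. norm (h u) \<le> C * (1 + norm u) ^ k))"

lemma poly_growthI:
  assumes "\<And>u. norm (h u) \<le> C * (1 + norm u) ^ k"
  shows "poly_growth h"
proof -
  have "0 \<le> C" using order_trans[OF norm_ge_zero assms, of 0] by simp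
  with assms show ?thesis unfolding poly_growth_def by blast
qed

lemma poly_growth_const: "poly_growth (\<lambda>u. c)"
  by (rule poly_growthI[where k = 0 and C = "norm c"]) simp

lemma poly_growth_id: "poly_growth (\<lambda>u. u)"
  by (rule poly_growthI[where k = 1 and C = 1]) simp

lemma poly_growth_norm: "poly_growth h \<Longrightarrow> poly_growth (\<lambda>u. norm (h u))"
  by (simp add: poly_growth_def)

lemma poly_growth_add:
  assumes "poly_growth g" "poly_growth h"
  shows "poly_growth (\<lambda>u. g u + h u)"
proof -
  obtain C k D l where C: "C \<ge> 0" "\<And>u. norm (g u) \<le> C * (1 + norm u) ^ k"
    and D: "D \<ge> 0" "\<And>u. norm (h u) \<le> D * (1 + norm u) ^ l"
    using assms unfolding poly_growth_def by blast
  have "norm (g u + h u) \<le> (C + D) * (1 + norm u) ^ (k + l)" for u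
  proof -
    have "C * (1 + norm u) ^ k \<le> C * (1 + norm u) ^ (k + l)"
      "D * (1 + norm u) ^ l \<le> D * (1 + norm u) ^ (k + l)"
      using C(1) D(1) by (auto intro!: mult_left_mono power_increasing)
    with C(2)[of u] D(2)[of u] norm_triangle_ineq[of "g u" "h u"] show ?thesis
      by (simp add: distrib_right)
  qed
  then show ?thesis by (rule poly_growthI)
qed

text \<open>Common source of the closure rules for \<open>*\<^sub>R\<close>, products and inner
  products, all of which satisfy such a norm inequality.\<close>

lemma poly_growth_bilinear:
  assumes "poly_growth g" "poly_growth h" "\<And>u. norm (p u) \<le> norm (g u) * norm (h u)"
  shows "poly_growth p"
proof -
  obtain C k D l where C: "C \<ge> 0" "\<And>u. norm (g u) \<le> C * (1 + norm u) ^ k"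
    and D: "D \<ge> 0" "\<And>u. norm (h u) \<le> D * (1 + norm u) ^ l"
    using assms unfolding poly_growth_def by blast
  have "norm (p u) \<le> (C * D) * (1 + norm u) ^ (k + l)" for u
    using order_trans[OF assms(3) mult_mono[OF C(2) D(2)], of u] C(1)
    by (simp add: power_add mult_ac)
  then show ?thesis by (rule poly_growthI)
qed

lemma poly_growth_scaleR: "poly_growth g \<Longrightarrow> poly_growth h \<Longrightarrow> poly_growth (\<lambda>u. g u *\<^sub>R h u)"
  by (erule (1) poly_growth_bilinear) simp

lemma poly_growth_mult:
  "poly_growth g \<Longrightarrow> poly_growth h \<Longrightarrow> poly_growth (\<lambda>u. g u * h u :: 'a::real_normed_algebra)"
  by (erule (1) poly_growth_bilinear) (rule norm_mult_ineq)

lemma poly_growth_inner: "poly_growth g \<Longrightarrow> poly_growth h \<Longrightarrow> poly_growth (\<lambda>u. inner (g u) (h u))"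
  by (erule (1) poly_growth_bilinear) (simp add: Cauchy_Schwarz_ineq2)

lemma poly_growth_mono:
  assumes "poly_growth g" "\<And>u. norm (h u) \<le> norm (g u)"
  shows "poly_growth h"
proof -
  obtain C k where "\<And>u. norm (g u) \<le> C * (1 + norm u) ^ k"
    using assms(1) unfolding poly_growth_def by blast
  then show ?thesis by (intro poly_growthI[OF order_trans[OF assms(2)]])
qed

lemma poly_growth_minus: "poly_growth h \<Longrightarrow> poly_growth (\<lambda>u. - h u)"
  by (simp add: poly_growth_def)

lemma poly_growth_diff: "poly_growth g \<Longrightarrow> poly_growth h \<Longrightarrow> poly_growth (\<lambda>u. g u - h u)"
  using poly_growth_add[of g "\<lambda>u. - h u"] poly_growth_minus[of h] by simp

lemma poly_growth_power:
  fixes h :: "_ \<Rightarrow> 'a::real_normed_algebra_1"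
  assumes "poly_growth h"
  shows "poly_growth (\<lambda>u. h u ^ n)"
proof (induction n)
  case 0
  show ?case using poly_growth_const[of 1] by simp
next
  case (Suc n)
  show ?case using poly_growth_mult[OF assms Suc] by simp
qed

lemmas poly_growth_intros = poly_growth_const poly_growth_id poly_growth_norm poly_growth_add
  poly_growth_minus poly_growth_diff poly_growth_power poly_growth_scaleR poly_growth_mult
  poly_growth_inner

text \<open>Since \<open>(1 + x / k) ^ k\<close> is at most \<open>exp x\<close>, it suffices to
  bound \<open>1 + t\<close> by a multiple of \<open>1 + c * t^2 / k\<close>.\<close>

lemma power_one_plus_le_exp:
  fixes c t :: real
  assumes "c > 0" "t \<ge> 0"
  shows "(1 + t) ^ k \<le> (2 + real k / c) ^ k * exp (c * t\<^sup>2)"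
proof (cases "k = 0")
  case False
  have "t \<le> 1 + t\<^sup>2"
    using sum_squares_bound[of t 1] assms(2) by (simp add: power2_eq_square)
  then have "1 + t \<le> 2 + t\<^sup>2" by simp
  \<comment> \<open>Expanding the product, \<open>2 * 1\<close> and
    \<open>(k / c) * (c * t^2 / k)\<close> already give the left side.\<close>
  also have "\<dots> \<le> (2 + real k / c) * (1 + c * t\<^sup>2 / real k)"
    using assms False by (simp add: field_simps)
  finally have "(1 + t) ^ k \<le> ((2 + real k / c) * (1 + c * t\<^sup>2 / real k)) ^ k"
    using assms by (intro power_mono) auto
  also have "\<dots> = (2 + real k / c) ^ k * (1 + c * t\<^sup>2 / real k) ^ k"
    by (rule power_mult_distrib)
  also have "\<dots> \<le> (2 + real k / c) ^ k * exp (c * t\<^sup>2)"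
  proof (rule mult_left_mono)
    have "0 \<le> c * t\<^sup>2" using assms by simp
    then have "- real k \<le> c * t\<^sup>2" by linarith
    with False show "(1 + c * t\<^sup>2 / real k) ^ k \<le> exp (c * t\<^sup>2)"
      by (intro exp_ge_one_plus_x_over_n_power_n) auto
    have "0 \<le> 2 + real k / c" using assms by simp
    then show "0 \<le> (2 + real k / c) ^ k" by (rule zero_le_power)
  qed
  finally show ?thesis .
qed (use assms in simp)

text \<open>A polynomial is absorbed by doubling the variance of the Gaussian.\<close>

lemma integrable_poly_growth_gauss_density:
  fixes h :: "'a::euclidean_space \<Rightarrow> 'b::{banach,second_countable_topology}"
  assumes lam: "lam > 0" and [measurable]: "h \<in> borel_measurable borel" and "poly_growth h"
  shows "integrable lborel (\<lambda>u. gauss_density lam u *\<^sub>R h u)"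
proof -
  obtain C k where C: "C \<ge> 0" "\<And>u. norm (h u) \<le> C * (1 + norm u) ^ k"
    using assms(3) unfolding poly_growth_def by blast
  define N1 where "N1 = (1 / sqrt (2 * pi / lam)) ^ DIM('a)"
  define N2 where "N2 = (1 / sqrt (2 * pi / (lam / 2))) ^ DIM('a)"
  have pos: "N1 > 0" "N2 > 0" using lam by (auto simp: N1_def N2_def)
  have half_pos_lam: "lam / 2 > 0" using lam by simp
  \<comment> \<open>The polynomial is paid for with \<open>exp (lam / 4 * norm u ^ 2)\<close>, which
    leaves the exponent \<open>- lam / 4\<close> of the Gaussian with parameter
    \<open>lam / 2\<close>. \<open>D\<close> collects the remaining constants and the ratio of the
    two normalizations.\<close>
  define D where "D = N1 * (C * (2 + real k / (lam / 4)) ^ k) / N2"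
  interpret P: prob_space "gauss (lam / 2) :: 'a measure"
    by (rule prob_space_gauss) (use lam in simp)
  have "integrable (gauss (lam / 2) :: 'a measure) (\<lambda>u. D)" by simp
  then have "integrable lborel (\<lambda>u::'a. gauss_density (lam / 2) u * D)"
    unfolding gauss_def by (subst (asm) integrable_density) (auto simp: gauss_density_nonneg)
  then show ?thesis
  proof (rule Bochner_Integration.integrable_bound)
    show "AE u in lborel. norm (gauss_density lam u *\<^sub>R h u) \<le> norm (gauss_density (lam / 2) (u::'a) * D)"
    proof (rule AE_I2)
      fix u :: 'a
      have "norm (gauss_density lam u *\<^sub>R h u) = gauss_density lam u * norm (h u)"
        by (simp add: gauss_density_nonneg)
      also have "\<dots> \<le> gauss_density lam u * (C * ((2 + real k / (lam / 4)) ^ k * exp (lam / 4 * (norm u)\<^sup>2)))"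
        by (intro mult_left_mono order_trans[OF C(2)] power_one_plus_le_exp gauss_density_nonneg C(1))
           (use lam in auto)
      also have "\<dots> = N1 * (C * (2 + real k / (lam / 4)) ^ k) *
           (exp (- (lam / 2) * (norm u)\<^sup>2) * exp (lam / 4 * (norm u)\<^sup>2))"
        using lam by (simp add: gauss_density_eq N1_def)
      also have "exp (- (lam / 2) * (norm u)\<^sup>2) * exp (lam / 4 * (norm u)\<^sup>2)
          = exp (- (lam / 2 / 2) * (norm u)\<^sup>2)"
        unfolding exp_add[symmetric] by (simp add: field_simps)
      also have "N1 * (C * (2 + real k / (lam / 4)) ^ k) * \<dots> = gauss_density (lam / 2) u * D"
        using pos unfolding gauss_density_eq[OF half_pos_lam] N2_def[symmetric] D_def by simp
      finally show "norm (gauss_density lam u *\<^sub>R h u) \<le> norm (gauss_density (lam / 2) u * D)"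
        by simp
    qed
  qed measurable
qed

lemma integrable_gauss_poly_growth:
  fixes h :: "'a::euclidean_space \<Rightarrow> 'b::{banach,second_countable_topology}"
  assumes "lam > 0" "h \<in> borel_measurable borel" "poly_growth h"
  shows "integrable (gauss lam) h"
  unfolding gauss_def
  using integrable_poly_growth_gauss_density[OF assms] assms(2)
  by (subst integrable_density) (auto simp: gauss_density_nonneg)

lemma integral_gauss:
  fixes h :: "'a::euclidean_space \<Rightarrow> 'b::{banach,second_countable_topology}"
  assumes "h \<in> borel_measurable borel"
  shows "integral\<^sup>L (gauss lam) h = (\<integral>u. gauss_density lam u *\<^sub>R h u \<partial>lborel)"
  unfolding gauss_def using assms by (subst integral_density) (auto simp: gauss_density_nonneg)

lemma lborel_integral_translate:
  fixes K :: "'a::euclidean_space \<Rightarrow> 'b::{banach,second_countable_topology}"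
  assumes "K \<in> borel_measurable borel"
  shows "(\<integral>u. K (u + c) \<partial>lborel) = (\<integral>u. K u \<partial>lborel)"
    and "integrable lborel (\<lambda>u. K (u + c)) \<longleftrightarrow> integrable lborel K"
proof -
  have "(\<integral>u. K u \<partial>lborel) = (\<integral>u. K u \<partial>distr lborel borel ((+) c))"
    by (subst lborel_distr_plus) simp
  also have "\<dots> = (\<integral>u. K (u + c) \<partial>lborel)"
    using assms by (subst integral_distr) (auto simp: add.commute)
  finally show "(\<integral>u. K (u + c) \<partial>lborel) = (\<integral>u. K u \<partial>lborel)" ..
  have "integrable lborel K \<longleftrightarrow> integrable (distr lborel borel ((+) c)) K"
    by (subst lborel_distr_plus) simp
  also have "\<dots> \<longleftrightarrow> integrable lborel (\<lambda>u. K (u + c))"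
    using assms by (subst integrable_distr_eq) (auto simp: add.commute)
  finally show "integrable lborel (\<lambda>u. K (u + c)) \<longleftrightarrow> integrable lborel K" ..
qed

text \<open>The difference \<open>K (u + b) - K u\<close> has integral zero by translation invariance, and it is the
  average over \<open>s\<close> in the unit interval of \<open>K' (u + s b)\<close>.\<close>

lemma lborel_integral_directional_derivative_eq_0:
  fixes K K' :: "'a::euclidean_space \<Rightarrow> real"
  assumes deriv: "\<And>u s. ((\<lambda>s. K (u + s *\<^sub>R b)) has_real_derivative K' (u + s *\<^sub>R b)) (at s)"
    and cont: "continuous_on UNIV K'"
    and int: "integrable lborel K" "integrable lborel K'"
  shows "(\<integral>u. K' u \<partial>lborel) = 0"
proof -
  have [measurable]: "K \<in> borel_measurable borel" "K' \<in> borel_measurable borel"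
    using int by (auto dest: borel_measurable_integrable)
  \<comment> \<open>The indicator restricts \<open>s\<close> to the unit interval while keeping the
    product of two full Lebesgue measures, on which Fubini is applied.\<close>
  define W where "W = (\<lambda>(s::real) (u::'a). K' (u + s *\<^sub>R b) * indicator {0..1} s)"
  have [measurable]: "case_prod W \<in> borel_measurable (lborel \<Otimes>\<^sub>M lborel)"
    unfolding W_def by measurable
  have inner_int: "integrable lborel (\<lambda>u. K' (u + s *\<^sub>R b))" for s
    using int by (subst lborel_integral_translate) auto
  have "integrable (lborel \<Otimes>\<^sub>M lborel) (case_prod W)"
  proof (rule lborel_pair.Fubini_integrable)
    have "(\<integral>u. norm (case_prod W (s, u)) \<partial>lborel)
        = indicator {0..1} s *\<^sub>R (\<integral>u. \<bar>K' u\<bar> \<partial>lborel)" for s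
      using lborel_integral_translate(1)[of "\<lambda>u. \<bar>K' u\<bar>" "s *\<^sub>R b"]
      by (simp add: W_def abs_mult mult.commute)
    then show "integrable lborel (\<lambda>s. \<integral>u. norm (case_prod W (s, u)) \<partial>lborel)"
      by (simp add: integrable_real_indicator)
    show "AE s in lborel. integrable lborel (\<lambda>u. case_prod W (s, u))"
      using inner_int by (auto simp: W_def)
  qed measurable
  then have swap: "(\<integral>u. (\<integral>s. W s u \<partial>lborel) \<partial>lborel) = (\<integral>s. (\<integral>u. W s u \<partial>lborel) \<partial>lborel)"
    by (rule lborel_pair.Fubini_integral)
  have W_u: "(\<integral>u. W s u \<partial>lborel) = indicator {0..1} s * (\<integral>u. K' u \<partial>lborel)" for s
    using lborel_integral_translate(1)[of K' "s *\<^sub>R b"] by (simp add: W_def mult.commute)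
  have W_s: "(\<integral>s. W s u \<partial>lborel) = K (u + 1 *\<^sub>R b) - K (u + 0 *\<^sub>R b)" for u
    unfolding W_def
  proof (rule integral_FTC_Icc_real)
    fix s :: real
    show "isCont (\<lambda>s. K' (u + s *\<^sub>R b)) s"
    proof (rule isCont_o2[where f = "\<lambda>s. u + s *\<^sub>R b" and g = K'])
      show "isCont (\<lambda>s. u + s *\<^sub>R b) s" by (intro continuous_intros)
      show "isCont K' (u + s *\<^sub>R b)" using cont by (simp add: continuous_on_eq_continuous_at)
    qed
  qed (use deriv in simp_all)
  have "(\<integral>u. K' u \<partial>lborel) = (\<integral>s. (\<integral>u. W s u \<partial>lborel) \<partial>lborel)"
    by (simp add: W_u)
  also have "\<dots> = (\<integral>u. K (u + b) - K u \<partial>lborel)"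
    by (simp add: swap[symmetric] W_s)
  also have "\<dots> = (\<integral>u. K (u + b) \<partial>lborel) - (\<integral>u. K u \<partial>lborel)"
    using int by (intro Bochner_Integration.integral_diff) (auto simp: lborel_integral_translate(2))
  also have "\<dots> = 0"
    by (simp add: lborel_integral_translate(1))
  finally show ?thesis .
qed

text \<open>Stein's identity: the density times \<open>h\<close> is integrable, so its derivative
  along \<open>b\<close> has integral zero. The factor \<open>lam\<close> comes from differentiating
  the exponent.\<close>

lemma gauss_integration_by_parts:
  fixes h :: "'a::euclidean_space \<Rightarrow> real"
  assumes lam: "lam > 0"
    and deriv: "\<And>u. GDERIV h u :> g u"
    and cont: "continuous_on UNIV g"
    and growth: "poly_growth h" "poly_growth g"
  shows "(\<integral>u. lam * inner u b * h u \<partial>gauss lam) = (\<integral>u. inner (g u) b \<partial>gauss lam)"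
proof -
  have h_cont: "continuous_on UNIV h"
    using deriv unfolding gderiv_def by (intro continuous_at_imp_continuous_on ballI has_derivative_continuous)
  have [measurable]: "h \<in> borel_measurable borel" "g \<in> borel_measurable borel"
    using h_cont cont by (auto intro: borel_measurable_continuous_onI)
  \<comment> \<open>\<open>K'\<close> times the density is the derivative along \<open>b\<close> of
    the density times \<open>h\<close>.\<close>
  define K' where "K' = (\<lambda>u. inner (g u) b - lam * inner u b * h u)"
  have [measurable]: "K' \<in> borel_measurable borel" unfolding K'_def by measurable
  have K'_growth: "poly_growth K'" unfolding K'_def by (intro poly_growth_intros growth)
  define c where "c = (1 / sqrt (2 * pi / lam)) ^ DIM('a)"
  have dens: "gauss_density lam u = c * exp (- (lam / 2) * inner u u)" for u :: 'a
    using lam by (simp add: gauss_density_eq c_def power2_norm_eq_inner)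
  have "(\<integral>u. gauss_density lam u * K' u \<partial>lborel) = 0"
  proof (rule lborel_integral_directional_derivative_eq_0[where K = "\<lambda>u. gauss_density lam u * h u" and b = b])
    show "integrable lborel (\<lambda>u. gauss_density lam u * K' u)"
      "integrable lborel (\<lambda>u. gauss_density lam u * h u)"
      using integrable_poly_growth_gauss_density[OF lam _ K'_growth]
        integrable_poly_growth_gauss_density[OF lam _ growth(1)] by auto
    show "continuous_on UNIV (\<lambda>u. gauss_density lam u * K' u)"
      unfolding dens K'_def by (intro continuous_intros cont h_cont)
    fix u :: 'a and s :: real
    have h': "((\<lambda>s. h (u + s *\<^sub>R b)) has_real_derivative inner b (g (u + s *\<^sub>R b))) (at s)"
      unfolding has_field_derivative_def
      by (rule has_derivative_eq_rhs[OF has_derivative_compose[OF _ deriv[unfolded gderiv_def]]])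
         (auto intro!: derivative_eq_intros simp: fun_eq_iff)
    have sq: "((\<lambda>s. inner (u + s *\<^sub>R b) (u + s *\<^sub>R b)) has_real_derivative 2 * inner (u + s *\<^sub>R b) b) (at s)"
      unfolding has_field_derivative_def
      by (auto intro!: derivative_eq_intros simp: fun_eq_iff inner_commute algebra_simps)
    show "((\<lambda>s. gauss_density lam (u + s *\<^sub>R b) * h (u + s *\<^sub>R b)) has_real_derivative
        gauss_density lam (u + s *\<^sub>R b) * K' (u + s *\<^sub>R b)) (at s)"
      unfolding dens
      by (rule derivative_eq_intros h' sq refl)+ (simp add: K'_def inner_commute algebra_simps)
  qed
  then have "(\<integral>u. K' u \<partial>gauss lam) = 0"
    by (subst integral_gauss) auto
  moreover have "(\<integral>u. K' u \<partial>gauss lam) = (\<integral>u. inner (g u) b \<partial>gauss lam) - (\<integral>u. lam * inner u b * h u \<partial>gauss lam)"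
    unfolding K'_def
    by (intro Bochner_Integration.integral_diff integrable_gauss_poly_growth lam poly_growth_intros growth)
       measurable
  ultimately show ?thesis by simp
qed

lemma gauss_mean_0:
  fixes b :: "'a::euclidean_space"
  assumes "lam > 0"
  shows "(\<integral>u. inner u b \<partial>gauss lam) = 0"
proof -
  have "(\<integral>u. lam * inner u b * 1 \<partial>gauss lam) = (\<integral>u. inner 0 b \<partial>(gauss lam :: 'a measure))"
    using assms by (intro gauss_integration_by_parts GDERIV_const poly_growth_intros) auto
  with assms show ?thesis by simp
qed

text \<open>Integration by parts with the coordinate function itself gives \<open>1 / lam\<close>
  for each basis vector.\<close>

lemma gauss_second_moment:
  assumes lam: "lam > 0"
  shows "(\<integral>u. (norm u)\<^sup>2 \<partial>(gauss lam :: 'a::euclidean_space measure)) = DIM('a) / lam"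
proof -
  have *: "(\<integral>u. (inner u b)\<^sup>2 \<partial>gauss lam) = 1 / lam" if "b \<in> Basis" for b :: 'a
  proof -
    interpret prob_space "gauss lam :: 'a measure" by (rule prob_space_gauss[OF lam])
    have "(\<integral>u. lam * inner u b * inner u b \<partial>gauss lam) = (\<integral>u. inner b b \<partial>(gauss lam :: 'a measure))"
      using assms by (intro gauss_integration_by_parts poly_growth_intros)
        (auto simp: gderiv_def intro!: derivative_eq_intros)
    also have "\<dots> = 1"
      using that prob_space by (simp add: inner_Basis)
    finally show ?thesis using lam by (simp add: power2_eq_square mult.assoc field_simps)
  qed
  have "(norm u)\<^sup>2 = (\<Sum>b\<in>Basis. (inner u b)\<^sup>2)" for u :: 'a
    unfolding power2_norm_eq_inner by (subst euclidean_inner) (simp add: power2_eq_square)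
  then have "(\<integral>u. (norm u)\<^sup>2 \<partial>(gauss lam :: 'a measure)) = (\<integral>u. (\<Sum>b\<in>(Basis::'a set). (inner u b)\<^sup>2) \<partial>gauss lam)"
    by simp
  also have "\<dots> = (\<Sum>b\<in>(Basis::'a set). (\<integral>u. (inner u b)\<^sup>2 \<partial>gauss lam))"
    by (intro Bochner_Integration.integral_sum integrable_gauss_poly_growth lam poly_growth_intros) auto
  finally show ?thesis using * by simp
qed

section \<open>Extragradient steps with an unbiased oracle\<close>

text \<open>Both sides are quadratic in the centre. The identity shows that the mean is the best
  centre, and with \<open>c = 0\<close> it expresses the second moment.\<close>

lemma (in prob_space) expectation_norm_diff_sq:
  fixes X :: "'a \<Rightarrow> 'b::euclidean_space"
  assumes X: "integrable M X" and X2: "integrable M (\<lambda>x. (norm (X x))\<^sup>2)"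
  shows "integrable M (\<lambda>x. (norm (X x - c))\<^sup>2)"
    and "expectation (\<lambda>x. (norm (X x - c))\<^sup>2)
      = expectation (\<lambda>x. (norm (X x - expectation X))\<^sup>2) + (norm (expectation X - c))\<^sup>2"
proof -
  have expand: "(norm (X x - c))\<^sup>2 = (norm (X x))\<^sup>2 - 2 * inner (X x) c + (norm c)\<^sup>2" for x c
    by (simp add: power2_norm_eq_inner inner_diff_left inner_diff_right inner_commute)
  have int: "integrable M (\<lambda>x. 2 * inner (X x) c)" for c
    using X by (intro integrable_mult_right integrable_inner_left) auto
  show "integrable M (\<lambda>x. (norm (X x - c))\<^sup>2)"
    unfolding expand using X2 int by (intro Bochner_Integration.integrable_add Bochner_Integration.integrable_diff) auto
  have E: "expectation (\<lambda>x. (norm (X x - c))\<^sup>2)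
      = expectation (\<lambda>x. (norm (X x))\<^sup>2) - 2 * inner (expectation X) c + (norm c)\<^sup>2" for c
    unfolding expand using X X2 int[of c] by (simp add: prob_space)
  show "expectation (\<lambda>x. (norm (X x - c))\<^sup>2)
      = expectation (\<lambda>x. (norm (X x - expectation X))\<^sup>2) + (norm (expectation X - c))\<^sup>2"
    unfolding E by (simp add: power2_norm_eq_inner inner_diff_left inner_diff_right inner_commute)
qed

text \<open>Conditioning on the past in Fubini form: the joint law of the family over
  \<open>A\<close> and of \<open>X i\<close> is a product measure. The map \<open>f\<close> extracts
  from the past what the integrand needs, later the current iterate. Nonnegative integrals avoid any
  a priori integrability of the iterates.\<close>

lemma (in prob_space) indep_vars_nn_integral_fresh:
  assumes indep: "indep_vars (\<lambda>_. N) X I" and i: "i \<in> I" "i \<notin> A" "A \<subseteq> I"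
    and f [measurable]: "f \<in> measurable (PiM A (\<lambda>_. N)) S"
    and h [measurable]: "h \<in> borel_measurable (S \<Otimes>\<^sub>M N)"
  shows "(\<integral>\<^sup>+\<omega>. h (f (\<lambda>j\<in>A. X j \<omega>), X i \<omega>) \<partial>M)
    = (\<integral>\<^sup>+\<omega>. (\<integral>\<^sup>+y. h (f (\<lambda>j\<in>A. X j \<omega>), y) \<partial>distr M N (X i)) \<partial>M)"
proof -
  \<comment> \<open>The fresh variable is first treated as a family over a singleton, the form in
    which independence of disjoint index sets is available; its component is read off in
    \<open>H\<close>.\<close>
  let ?XA = "\<lambda>\<omega>. \<lambda>j\<in>A. X j \<omega>" and ?Xi = "\<lambda>\<omega>. \<lambda>j\<in>{i}. X j \<omega>"
  let ?PA = "PiM A (\<lambda>_. N)" and ?Pi = "PiM {i} (\<lambda>_. N)"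
  have ind: "indep_var ?PA ?XA ?Pi ?Xi"
    using i by (intro indep_var_restrict[OF indep]) auto
  then have [measurable]: "?XA \<in> measurable M ?PA" "?Xi \<in> measurable M ?Pi"
    and prod: "distr M ?PA ?XA \<Otimes>\<^sub>M distr M ?Pi ?Xi = distr M (?PA \<Otimes>\<^sub>M ?Pi) (\<lambda>\<omega>. (?XA \<omega>, ?Xi \<omega>))"
    unfolding indep_var_distribution_eq by blast+
  have [measurable]: "X i \<in> measurable M N"
    using indep i by (auto simp: indep_vars_def)
  have [measurable]: "(\<lambda>x. x i) \<in> measurable ?Pi N" by (rule measurable_component_singleton) simp
  interpret Y: prob_space "distr M ?Pi ?Xi" by (rule prob_space_distr) measurable
  define H where "H = (\<lambda>p. h (f (fst p), snd p i))"
  have [measurable]: "H \<in> borel_measurable (?PA \<Otimes>\<^sub>M ?Pi)" unfolding H_def by measurable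
  have "(\<integral>\<^sup>+\<omega>. h (f (?XA \<omega>), X i \<omega>) \<partial>M) = (\<integral>\<^sup>+\<omega>. H (?XA \<omega>, ?Xi \<omega>) \<partial>M)"
    by (simp add: H_def)
  also have "\<dots> = (\<integral>\<^sup>+p. H p \<partial>distr M (?PA \<Otimes>\<^sub>M ?Pi) (\<lambda>\<omega>. (?XA \<omega>, ?Xi \<omega>)))"
    by (subst nn_integral_distr) measurable
  also have "\<dots> = (\<integral>\<^sup>+x. (\<integral>\<^sup>+y. H (x, y) \<partial>distr M ?Pi ?Xi) \<partial>distr M ?PA ?XA)"
    unfolding prod[symmetric] by (subst Y.nn_integral_fst[symmetric]) auto
  also have "\<dots> = (\<integral>\<^sup>+\<omega>. (\<integral>\<^sup>+y. H (?XA \<omega>, y) \<partial>distr M ?Pi ?Xi) \<partial>M)"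
    by (subst nn_integral_distr) auto
  also have "\<dots> = (\<integral>\<^sup>+\<omega>. (\<integral>\<^sup>+\<omega>'. H (?XA \<omega>, ?Xi \<omega>') \<partial>M) \<partial>M)"
    by (intro nn_integral_cong, subst nn_integral_distr) (auto simp: space_PiM)
  also have "\<dots> = (\<integral>\<^sup>+\<omega>. (\<integral>\<^sup>+y. h (f (?XA \<omega>), y) \<partial>distr M N (X i)) \<partial>M)"
    by (intro nn_integral_cong, subst nn_integral_distr) (auto simp: H_def)
  finally show ?thesis .
qed

section \<open>One extragradient iteration with a noisy oracle\<close>

text \<open>Isolates what the analysis of the iterates uses about the oracle. \<open>\<eta>\<close>
  is the defect in the weak Minty inequality, and the condition on \<open>c\<close> makes the final
  coefficient of \<open>norm (m y) ^ 2\<close> in the descent estimate nonpositive.\<close>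

locale noisy_extragradient = P: prob_space P
  for P :: "'a::euclidean_space measure" +
  fixes G :: "'a \<Rightarrow> 'a \<Rightarrow> 'a" and m :: "'a \<Rightarrow> 'a" and zstar z0 :: 'a
    and L s2 h1 h2 \<kappa> \<eta> c :: real
  assumes sets_P [measurable_cong, simp]: "sets P = sets borel"
    and G_measurable [measurable]: "case_prod G \<in> borel_measurable (borel \<Otimes>\<^sub>M borel)"
    and G_integrable: "\<And>z. integrable P (G z)"
    and G_sq_integrable: "\<And>z. integrable P (\<lambda>v. (norm (G z v))\<^sup>2)"
    and G_mean: "\<And>z. (\<integral>v. G z v \<partial>P) = m z"
    and G_variance: "\<And>z. (\<integral>v. (norm (G z v - m z))\<^sup>2 \<partial>P) \<le> s2"
    and m_lipschitz: "\<And>z w. norm (m z - m w) \<le> L * norm (z - w)"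
    and weak_minty: "\<And>z. - \<kappa> * (norm (m z))\<^sup>2 - \<eta> \<le> inner (m z) (z - zstar)"
    and h1: "0 \<le> h1" "L * h1 \<le> 1" and h2: "0 \<le> h2"
    and c: "0 \<le> c" "2 * h2 * \<kappa> + h2\<^sup>2 + c \<le> h1 * h2"
    and L: "0 \<le> L" and \<eta>: "0 \<le> \<eta>"
begin

text \<open>The loss per iteration. Of the three variances weighted by \<open>h1 * h2\<close>, one
  comes from the second moment of the first oracle value and two from its correlation with
  \<open>m\<close> at the extrapolated point; \<open>h2^2 * s2\<close> is the noise of the second
  oracle value.\<close>

definition err :: real where "err = 2 * h2 * \<eta> + (3 * h1 * h2 + h2\<^sup>2) * s2"

lemma m_measurable [measurable]: "m \<in> borel_measurable borel"
proof (intro borel_measurable_continuous_onI lipschitz_on_continuous_on[of L] lipschitz_onI L)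
  show "dist (m x) (m y) \<le> L * dist x y" for x y using m_lipschitz by (simp add: dist_norm)
qed

lemma s2_nonneg: "0 \<le> s2"
  by (rule order_trans[OF Bochner_Integration.integral_nonneg G_variance]) simp

lemma err_nonneg: "0 \<le> err"
  unfolding err_def using h1 h2 \<eta> s2_nonneg by simp

text \<open>Bias-variance decomposition of the update with the evaluation point \<open>y\<close>
  held fixed.\<close>

lemma second_moment_step:
  "(\<integral>\<^sup>+w. ennreal ((norm (z - h2 *\<^sub>R G y w - zstar))\<^sup>2) \<partial>P)
     \<le> ennreal ((norm (z - zstar - h2 *\<^sub>R m y))\<^sup>2 + h2\<^sup>2 * s2)"
proof -
  define X where "X = (\<lambda>w. h2 *\<^sub>R G y w)"
  have X: "integrable P X" "integrable P (\<lambda>w. (norm (X w))\<^sup>2)"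
    using G_integrable[of y] G_sq_integrable[of y] by (auto simp: X_def power_mult_distrib)
  have EX: "P.expectation X = h2 *\<^sub>R m y" by (simp add: X_def G_mean)
  have [simp]: "norm (z - X w - zstar) = norm (X w - (z - zstar))" for w
    by (subst norm_minus_commute) (simp add: algebra_simps)
  have "P.expectation (\<lambda>w. (norm (X w - (z - zstar)))\<^sup>2)
      = h2\<^sup>2 * P.expectation (\<lambda>w. (norm (G y w - m y))\<^sup>2) + (norm (h2 *\<^sub>R m y - (z - zstar)))\<^sup>2"
    by (subst P.expectation_norm_diff_sq(2)[OF X])
      (simp add: EX, simp add: X_def scaleR_diff_right[symmetric] power_mult_distrib)
  also have "\<dots> \<le> (norm (z - zstar - h2 *\<^sub>R m y))\<^sup>2 + h2\<^sup>2 * s2"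
    using mult_left_mono[OF G_variance[of y], of "h2\<^sup>2"] by (simp add: norm_minus_commute)
  finally have *: "P.expectation (\<lambda>w. (norm (X w - (z - zstar)))\<^sup>2)
      \<le> (norm (z - zstar - h2 *\<^sub>R m y))\<^sup>2 + h2\<^sup>2 * s2" .
  have "(\<integral>\<^sup>+w. ennreal ((norm (z - X w - zstar))\<^sup>2) \<partial>P)
      = ennreal (P.expectation (\<lambda>w. (norm (X w - (z - zstar)))\<^sup>2))"
    using P.expectation_norm_diff_sq(1)[OF X] by (simp add: nn_integral_eq_integral)
  also have "\<dots> \<le> ennreal ((norm (z - zstar - h2 *\<^sub>R m y))\<^sup>2 + h2\<^sup>2 * s2)"
    using * by (rule ennreal_leI)
  finally show ?thesis by (simp add: X_def)
qed

text \<open>With \<open>\<xi> = g - m z\<close>, the inner product of \<open>\<xi>\<close> with \<open>m (z - h1 g)\<close> is compared to its inner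
  product with the deterministic vector \<open>m (z - h1 (m z))\<close>, which has mean zero; the Lipschitz bound
  makes the difference quadratic in \<open>\<xi>\<close>.\<close>

lemma descent_pointwise:
  fixes z g :: 'a
  defines "y \<equiv> z - h1 *\<^sub>R g"
  shows "(norm (z - zstar - h2 *\<^sub>R m y))\<^sup>2 + c * (norm (m y))\<^sup>2
    \<le> (norm (z - zstar))\<^sup>2 + 2 * h2 * \<eta>
      + h1 * h2 * ((norm g)\<^sup>2 - (norm (m z))\<^sup>2 + 2 * (norm (g - m z))\<^sup>2
          - 2 * inner (g - m z) (m (z - h1 *\<^sub>R m z)))"
proof -
  define \<xi> where "\<xi> = g - m z"
  define m1 where "m1 = m (z - h1 *\<^sub>R m z)"
  \<comment> \<open>As \<open>y\<close> and \<open>z\<close> differ by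
    \<open>h1 *\<^sub>R g\<close>, the condition \<open>L * h1 \<le> 1\<close> bounds the change of
    \<open>m\<close>. Expanding the square then controls \<open>inner (m y) (m z)\<close> from
    below.\<close>
  have "(norm (m y - m z))\<^sup>2 \<le> (norm g)\<^sup>2"
  proof (rule power_mono)
    have "norm (m y - m z) \<le> L * h1 * norm g"
      using m_lipschitz[of y z] h1 by (simp add: y_def mult.assoc)
    also have "\<dots> \<le> 1 * norm g" using h1 by (intro mult_right_mono) auto
    finally show "norm (m y - m z) \<le> norm g" by simp
  qed simp
  moreover have "(norm (m y - m z))\<^sup>2 = (norm (m y))\<^sup>2 - 2 * inner (m y) (m z) + (norm (m z))\<^sup>2"
    by (simp add: power2_norm_eq_inner inner_diff_left inner_diff_right inner_commute)
  ultimately have 1: "- 2 * inner (m y) (m z) \<le> (norm g)\<^sup>2 - (norm (m z))\<^sup>2 - (norm (m y))\<^sup>2"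
    by simp
  have "- inner (m y - m1) \<xi> \<le> norm (m y - m1) * norm \<xi>"
    using Cauchy_Schwarz_ineq2[of "m y - m1" \<xi>] by simp
  also have "norm (m y - m1) \<le> L * h1 * norm \<xi>"
  proof -
    have "y - (z - h1 *\<^sub>R m z) = - (h1 *\<^sub>R \<xi>)" by (simp add: y_def \<xi>_def algebra_simps)
    then show ?thesis using m_lipschitz[of y "z - h1 *\<^sub>R m z"] h1 by (simp add: m1_def mult.assoc)
  qed
  also have "\<dots> \<le> 1 * norm \<xi>" using h1 by (intro mult_right_mono) auto
  finally have "- inner (m y - m1) \<xi> \<le> (norm \<xi>)\<^sup>2"
    by (simp add: power2_eq_square mult_right_mono)
  then have 2: "- 2 * inner (m y) \<xi> \<le> 2 * (norm \<xi>)\<^sup>2 - 2 * inner \<xi> m1"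
    by (simp add: inner_diff_left inner_commute[of m1])
  \<comment> \<open>Adds the two estimates, since \<open>g\<close> is the sum of \<open>m z\<close>
    and \<open>\<xi>\<close>.\<close>
  have 3: "- 2 * inner (m y) g \<le> (norm g)\<^sup>2 - (norm (m z))\<^sup>2 + 2 * (norm \<xi>)\<^sup>2 - 2 * inner \<xi> m1 - (norm (m y))\<^sup>2"
    using 1 2 by (simp add: \<xi>_def inner_diff_right)
  have "(norm (z - zstar - h2 *\<^sub>R m y))\<^sup>2 + c * (norm (m y))\<^sup>2
      = (norm (z - zstar))\<^sup>2 - 2 * h2 * inner (m y) (z - zstar) + (h2\<^sup>2 + c) * (norm (m y))\<^sup>2"
  proof -
    have "(norm (a - h2 *\<^sub>R b))\<^sup>2 = (norm a)\<^sup>2 - 2 * h2 * inner b a + h2\<^sup>2 * (norm b)\<^sup>2" for a b :: 'a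
      unfolding power2_norm_eq_inner
      by (simp add: inner_diff_left inner_diff_right inner_commute power2_eq_square)
    then show ?thesis by (simp add: distrib_right)
  qed
  \<comment> \<open>Moving the base point from \<open>z\<close> to \<open>y\<close> allows the weak
    Minty inequality to be used at \<open>y\<close>; the remainder is what estimate \<open>3\<close>
    controls.\<close>
  also have "inner (m y) (z - zstar) = inner (m y) (y - zstar) + h1 * inner (m y) g"
    by (simp add: y_def inner_diff_right)
  also have "(norm (z - zstar))\<^sup>2 - 2 * h2 * (inner (m y) (y - zstar) + h1 * inner (m y) g) + (h2\<^sup>2 + c) * (norm (m y))\<^sup>2
     = (norm (z - zstar))\<^sup>2 + 2 * h2 * (- inner (m y) (y - zstar)) + h1 * h2 * (- 2 * inner (m y) g) + (h2\<^sup>2 + c) * (norm (m y))\<^sup>2"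
    by (simp add: algebra_simps)
  also have "\<dots> \<le> (norm (z - zstar))\<^sup>2 + 2 * h2 * (\<kappa> * (norm (m y))\<^sup>2 + \<eta>)
      + h1 * h2 * ((norm g)\<^sup>2 - (norm (m z))\<^sup>2 + 2 * (norm \<xi>)\<^sup>2 - 2 * inner \<xi> m1 - (norm (m y))\<^sup>2)
      + (h2\<^sup>2 + c) * (norm (m y))\<^sup>2"
    using 3 weak_minty[of y] h1 h2 by (intro add_mono mult_left_mono order_refl) auto
  also have "\<dots> = (norm (z - zstar))\<^sup>2 + 2 * h2 * \<eta>
      + h1 * h2 * ((norm g)\<^sup>2 - (norm (m z))\<^sup>2 + 2 * (norm \<xi>)\<^sup>2 - 2 * inner \<xi> m1)
      + (2 * h2 * \<kappa> + h2\<^sup>2 + c - h1 * h2) * (norm (m y))\<^sup>2"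
    by (simp add: algebra_simps)
  also have "\<dots> \<le> (norm (z - zstar))\<^sup>2 + 2 * h2 * \<eta>
      + h1 * h2 * ((norm g)\<^sup>2 - (norm (m z))\<^sup>2 + 2 * (norm \<xi>)\<^sup>2 - 2 * inner \<xi> m1)"
    using c mult_nonpos_nonneg[of "2 * h2 * \<kappa> + h2\<^sup>2 + c - h1 * h2" "(norm (m y))\<^sup>2"] by simp
  finally show ?thesis by (simp add: \<xi>_def m1_def)
qed

text \<open>The second sample is averaged for fixed \<open>v\<close>, after which the pointwise
  estimate is averaged over \<open>v\<close>.\<close>

lemma expected_descent:
  "(\<integral>\<^sup>+v. (\<integral>\<^sup>+w. ennreal ((norm (z - h2 *\<^sub>R G (z - h1 *\<^sub>R G z v) w - zstar))\<^sup>2) \<partial>P) \<partial>P)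
     + ennreal c * (\<integral>\<^sup>+v. ennreal ((norm (m (z - h1 *\<^sub>R G z v)))\<^sup>2) \<partial>P)
   \<le> ennreal ((norm (z - zstar))\<^sup>2 + err)"
proof -
  define y where "y = (\<lambda>v. z - h1 *\<^sub>R G z v)"
  define m1 where "m1 = m (z - h1 *\<^sub>R m z)"
  define B where "B = (\<lambda>v. (norm (z - zstar))\<^sup>2 + 2 * h2 * \<eta>
      + h1 * h2 * ((norm (G z v))\<^sup>2 - (norm (m z))\<^sup>2 + 2 * (norm (G z v - m z))\<^sup>2
          - 2 * inner (G z v - m z) m1) + h2\<^sup>2 * s2)"
  have [measurable]: "y \<in> borel_measurable borel" unfolding y_def by measurable
  note int = G_integrable[of z] G_sq_integrable[of z]
  note var_int = P.expectation_norm_diff_sq(1)[OF int, of "m z"]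
  have pt: "(norm (z - zstar - h2 *\<^sub>R m (y v)))\<^sup>2 + h2\<^sup>2 * s2 + c * (norm (m (y v)))\<^sup>2 \<le> B v" for v
    using descent_pointwise[of z "G z v"] by (simp add: B_def y_def m1_def)
  have B0: "0 \<le> B v" for v
    using s2_nonneg c(1) by (intro order_trans[OF _ pt]) auto
  have B_int: "integrable P B"
    unfolding B_def using int var_int by auto
  have E1: "P.expectation (\<lambda>v. (norm (G z v))\<^sup>2)
      = P.expectation (\<lambda>v. (norm (G z v - m z))\<^sup>2) + (norm (m z))\<^sup>2"
    using P.expectation_norm_diff_sq(2)[OF int, of 0] by (simp add: G_mean)
  \<comment> \<open>The cross term vanishes because \<open>m1\<close> does not depend on the
    sample.\<close>
  have E2: "P.expectation (\<lambda>v. inner (G z v - m z) m1) = 0"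
    using int by (simp add: G_mean P.prob_space)
  have "P.expectation B = (norm (z - zstar))\<^sup>2 + 2 * h2 * \<eta>
      + h1 * h2 * (3 * P.expectation (\<lambda>v. (norm (G z v - m z))\<^sup>2)) + h2\<^sup>2 * s2"
    unfolding B_def using int var_int E1 E2 by (simp add: P.prob_space)
  also have "\<dots> \<le> (norm (z - zstar))\<^sup>2 + 2 * h2 * \<eta> + h1 * h2 * (3 * s2) + h2\<^sup>2 * s2"
    using G_variance[of z] h1 h2 by (intro add_mono mult_left_mono order_refl) auto
  finally have EB: "P.expectation B \<le> (norm (z - zstar))\<^sup>2 + err"
    by (simp add: err_def algebra_simps)
  have "(\<integral>\<^sup>+v. (\<integral>\<^sup>+w. ennreal ((norm (z - h2 *\<^sub>R G (y v) w - zstar))\<^sup>2) \<partial>P) \<partial>P)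
     + ennreal c * (\<integral>\<^sup>+v. ennreal ((norm (m (y v)))\<^sup>2) \<partial>P)
    \<le> (\<integral>\<^sup>+v. ennreal ((norm (z - zstar - h2 *\<^sub>R m (y v)))\<^sup>2 + h2\<^sup>2 * s2) \<partial>P)
     + ennreal c * (\<integral>\<^sup>+v. ennreal ((norm (m (y v)))\<^sup>2) \<partial>P)"
    by (intro add_mono nn_integral_mono second_moment_step order_refl)
  also have "\<dots> = (\<integral>\<^sup>+v. ennreal ((norm (z - zstar - h2 *\<^sub>R m (y v)))\<^sup>2 + h2\<^sup>2 * s2) + ennreal c * ennreal ((norm (m (y v)))\<^sup>2) \<partial>P)"
    by (simp add: nn_integral_add nn_integral_cmult)
  also have "\<dots> = (\<integral>\<^sup>+v. ennreal ((norm (z - zstar - h2 *\<^sub>R m (y v)))\<^sup>2 + h2\<^sup>2 * s2 + c * (norm (m (y v)))\<^sup>2) \<partial>P)"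
    using c s2_nonneg by (intro nn_integral_cong) (simp add: ennreal_mult[symmetric] ennreal_plus[symmetric] del: ennreal_plus)
  also have "\<dots> \<le> (\<integral>\<^sup>+v. ennreal (B v) \<partial>P)"
    by (intro nn_integral_mono ennreal_leI pt)
  also have "\<dots> = ennreal (P.expectation B)"
    using B_int B0 by (simp add: nn_integral_eq_integral)
  also have "\<dots> \<le> ennreal ((norm (z - zstar))\<^sup>2 + err)"
    using EB by (rule ennreal_leI)
  finally show ?thesis by (simp add: y_def)
qed

section \<open>The random iterates and the telescoping sum\<close>

text \<open>The iterate as a deterministic function of the sample values, which makes its dependence
  on finitely many samples expressible. \<open>Inl\<close> tags the extrapolation samples and
  \<open>Inr\<close> the update samples.\<close>

primrec iter :: "nat \<Rightarrow> (nat + nat \<Rightarrow> 'a) \<Rightarrow> 'a" where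
  "iter 0 x = z0"
| "iter (Suc k) x = iter k x - h2 *\<^sub>R G (iter k x - h1 *\<^sub>R G (iter k x) (x (Inl k))) (x (Inr k))"

text \<open>Allows \<open>iter k\<close> to be evaluated on the restricted families supplied by
  independence without changing its value.\<close>

lemma iter_cong:
  "(\<And>i. i \<in> {..<k} <+> {..<k} \<Longrightarrow> x i = y i) \<Longrightarrow> iter k x = iter k y"
proof (induction k)
  case (Suc k)
  have "iter k x = iter k y" by (intro Suc.IH Suc.prems) auto
  moreover have "x (Inl k) = y (Inl k)" "x (Inr k) = y (Inr k)" using Suc.prems by auto
  ultimately show ?case by simp
qed simp

lemma iter_measurable:
  "{..<k} <+> {..<k} \<subseteq> A \<Longrightarrow> iter k \<in> borel_measurable (PiM A (\<lambda>_. borel))"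
proof (induction k)
  case 0
  have "iter 0 = (\<lambda>x. z0)" by (simp add: fun_eq_iff)
  then show ?case by simp
next
  case (Suc k)
  have [measurable]: "iter k \<in> borel_measurable (PiM A (\<lambda>_. borel))"
    using Suc.prems by (intro Suc.IH) auto
  have "Inl k \<in> A" "Inr k \<in> A" using Suc.prems by auto
  then have [measurable]: "(\<lambda>x. x (Inl k)) \<in> borel_measurable (PiM A (\<lambda>_. borel))"
    "(\<lambda>x. x (Inr k)) \<in> borel_measurable (PiM A (\<lambda>_. borel))"
    by (auto intro: measurable_component_singleton)
  have "iter (Suc k) = (\<lambda>x. iter k x - h2 *\<^sub>R G (iter k x - h1 *\<^sub>R G (iter k x) (x (Inl k))) (x (Inr k)))"
    by (simp add: fun_eq_iff)
  then show ?case by simp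
qed

text \<open>The expected squared distance to \<open>zstar\<close> drops in each step by
  \<open>c\<close> times the expected squared operator norm, up to \<open>err\<close>; summing over
  the steps telescopes. Working in \<open>ennreal\<close> makes every expectation meaningful from
  the start.\<close>

theorem expected_operator_sum_bound:
  fixes M :: "'w measure" and u uhat z zhat :: "nat \<Rightarrow> 'w \<Rightarrow> 'a" and N :: nat
  assumes "prob_space M"
    and law: "\<And>k. k \<le> N \<Longrightarrow> distr M borel (uhat k) = P" "\<And>k. k \<le> N \<Longrightarrow> distr M borel (u k) = P"
    and indep: "prob_space.indep_vars M (\<lambda>_. borel) (case_sum uhat u) ({..N} <+> {..N})"
    and z_0: "\<And>\<omega>. \<omega> \<in> space M \<Longrightarrow> z 0 \<omega> = z0"
    and zhat: "\<And>k \<omega>. k \<le> N \<Longrightarrow> \<omega> \<in> space M \<Longrightarrow> zhat k \<omega> = z k \<omega> - h1 *\<^sub>R G (z k \<omega>) (uhat k \<omega>)"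
    and z_Suc: "\<And>k \<omega>. k \<le> N \<Longrightarrow> \<omega> \<in> space M \<Longrightarrow> z (Suc k) \<omega> = z k \<omega> - h2 *\<^sub>R G (zhat k \<omega>) (u k \<omega>)"
  shows "ennreal c * (\<Sum>k\<le>N. \<integral>\<^sup>+\<omega>. ennreal ((norm (m (zhat k \<omega>)))\<^sup>2) \<partial>M)
      \<le> ennreal ((norm (z0 - zstar))\<^sup>2 + (real N + 1) * err)"
    and "\<And>k. k \<le> N \<Longrightarrow> zhat k \<in> borel_measurable M"
proof -
  interpret M: prob_space M by fact
  define X where "X = (\<lambda>\<omega> i. case_sum uhat u i \<omega>)"
  have X_simps: "X \<omega> (Inl k) = uhat k \<omega>" "X \<omega> (Inr k) = u k \<omega>" for \<omega> k by (auto simp: X_def)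
  have z_iter: "z k \<omega> = iter k (X \<omega>)" if "k \<le> Suc N" "\<omega> \<in> space M" for k \<omega>
    using that by (induction k) (auto simp: z_0 z_Suc zhat X_simps)
  have uhat_rv: "uhat k \<in> borel_measurable M" and u_rv: "u k \<in> borel_measurable M" if "k \<le> N" for k
    using M.indep_vars_def2[THEN iffD1, OF indep] that by (auto dest: bspec[where x = "Inl k"] bspec[where x = "Inr k"])
  \<comment> \<open>\<open>V k\<close> agrees with \<open>z k\<close> on \<open>space M\<close> up
    to index \<open>Suc N\<close>, and is a function of the samples at every
    \<open>\<omega>\<close>.\<close>
  define V where "V = (\<lambda>k \<omega>. iter k (X \<omega>))"
  have restr: "iter k (restrict (X \<omega>) A) = V k \<omega>" if "{..<k} <+> {..<k} \<subseteq> A" for A k \<omega>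
    unfolding V_def using that by (intro iter_cong) auto
  have V_rv: "V k \<in> borel_measurable M" if "k \<le> Suc N" for k
    unfolding V_def using that
  proof (induction k)
    case (Suc k)
    then have [measurable]: "(\<lambda>\<omega>. iter k (X \<omega>)) \<in> borel_measurable M" by auto
    have [measurable]: "u k \<in> borel_measurable M" "uhat k \<in> borel_measurable M"
      using Suc.prems uhat_rv u_rv by auto
    show ?case by (simp add: X_simps)
  qed simp
  have zhat_V: "zhat k \<omega> = V k \<omega> - h1 *\<^sub>R G (V k \<omega>) (uhat k \<omega>)" if "k \<le> N" "\<omega> \<in> space M" for k \<omega>
    using that by (simp add: zhat z_iter V_def)
  show zhat_rv: "zhat k \<in> borel_measurable M" if "k \<le> N" for k
  proof -
    have [measurable]: "V k \<in> borel_measurable M" "uhat k \<in> borel_measurable M"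
      using that V_rv uhat_rv by auto
    show ?thesis
      by (subst measurable_cong[OF zhat_V[OF that]]) auto
  qed
  have fresh_uhat: "(\<integral>\<^sup>+\<omega>. h (V k \<omega>) (uhat k \<omega>) \<partial>M) = (\<integral>\<^sup>+\<omega>. (\<integral>\<^sup>+v. h (V k \<omega>) v \<partial>P) \<partial>M)"
    if k: "k \<le> N" and h: "case_prod h \<in> borel_measurable (borel \<Otimes>\<^sub>M borel)" for h k
  proof -
    let ?A = "{..<k} <+> {..<k}"
    have "iter k \<in> borel_measurable (PiM ?A (\<lambda>_. borel))" by (rule iter_measurable) simp
    moreover have "Inl k \<in> {..N} <+> {..N}" "Inl k \<notin> ?A" "?A \<subseteq> {..N} <+> {..N}" using k by auto
    ultimately show ?thesis
      using M.indep_vars_nn_integral_fresh[OF indep _ _ _ _ h, of "Inl k" ?A "iter k"]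
        restr[of k ?A] law(1)[OF k] by (simp add: X_def)
  qed
  have fresh_u: "(\<integral>\<^sup>+\<omega>. h (V k \<omega>) (uhat k \<omega>) (u k \<omega>) \<partial>M) = (\<integral>\<^sup>+\<omega>. (\<integral>\<^sup>+v. h (V k \<omega>) (uhat k \<omega>) v \<partial>P) \<partial>M)"
    if k: "k \<le> N" and h: "(\<lambda>p. h (fst (fst p)) (snd (fst p)) (snd p)) \<in> borel_measurable ((borel \<Otimes>\<^sub>M borel) \<Otimes>\<^sub>M borel)" for h k
  proof -
    \<comment> \<open>The past now includes the extrapolation sample of the same iteration, because
      the second oracle call is made at \<open>zhat k\<close>.\<close>
    let ?A = "insert (Inl k) ({..<k} <+> {..<k})"
    have "(\<lambda>x. (iter k x, x (Inl k))) \<in> measurable (PiM ?A (\<lambda>_. borel)) (borel \<Otimes>\<^sub>M borel)"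
      by (intro measurable_Pair iter_measurable measurable_component_singleton) auto
    moreover have "Inr k \<in> {..N} <+> {..N}" "Inr k \<notin> ?A" "?A \<subseteq> {..N} <+> {..N}" using k by auto
    moreover have "iter k (\<lambda>j\<in>?A. case_sum uhat u j \<omega>) = V k \<omega>" for \<omega>
      using restr[of k ?A \<omega>] by (auto simp: X_def)
    ultimately show ?thesis
      using M.indep_vars_nn_integral_fresh[OF indep _ _ _ _ h, of "Inr k" ?A "\<lambda>x. (iter k x, x (Inl k))"]
        law(2)[OF k] by simp
  qed
  define D where "D = (\<lambda>k. \<integral>\<^sup>+\<omega>. ennreal ((norm (V k \<omega> - zstar))\<^sup>2) \<partial>M)"
  define Q where "Q = (\<lambda>k. \<integral>\<^sup>+\<omega>. ennreal ((norm (m (zhat k \<omega>)))\<^sup>2) \<partial>M)"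
  have step: "D (Suc k) + ennreal c * Q k \<le> D k + ennreal err" if k: "k \<le> N" for k
  proof -
    have [measurable]: "V k \<in> borel_measurable M" using V_rv that by simp
    define \<psi> where "\<psi> = (\<lambda>z v w. ennreal ((norm (z - h2 *\<^sub>R G (z - h1 *\<^sub>R G z v) w - zstar))\<^sup>2))"
    define q where "q = (\<lambda>z v. ennreal ((norm (m (z - h1 *\<^sub>R G z v)))\<^sup>2))"
    have [measurable]: "(\<lambda>p. \<psi> (fst (fst p)) (snd (fst p)) (snd p)) \<in> borel_measurable ((borel \<Otimes>\<^sub>M borel) \<Otimes>\<^sub>M borel)"
      unfolding \<psi>_def by measurable
    have [measurable]: "(\<lambda>(z, v). \<integral>\<^sup>+w. \<psi> z v w \<partial>P) \<in> borel_measurable (borel \<Otimes>\<^sub>M borel)"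
      unfolding \<psi>_def by measurable
    have [measurable]: "(\<lambda>(z, v). q z v) \<in> borel_measurable (borel \<Otimes>\<^sub>M borel)"
      unfolding q_def by measurable
    \<comment> \<open>Samples are averaged out from newest to oldest: first \<open>u k\<close>, then
      \<open>uhat k\<close>. What remains is the double integral of the one-step estimate at
      \<open>V k\<close>.\<close>
    have "D (Suc k) = (\<integral>\<^sup>+\<omega>. \<psi> (V k \<omega>) (uhat k \<omega>) (u k \<omega>) \<partial>M)"
      by (simp add: D_def V_def \<psi>_def X_simps)
    also have "\<dots> = (\<integral>\<^sup>+\<omega>. (\<integral>\<^sup>+w. \<psi> (V k \<omega>) (uhat k \<omega>) w \<partial>P) \<partial>M)"
      by (rule fresh_u[OF k]) measurable
    also have "\<dots> = (\<integral>\<^sup>+\<omega>. (\<integral>\<^sup>+v. (\<integral>\<^sup>+w. \<psi> (V k \<omega>) v w \<partial>P) \<partial>P) \<partial>M)"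
      by (rule fresh_uhat[OF k]) measurable
    finally have D_Suc: "D (Suc k) = \<dots>" .
    have "Q k = (\<integral>\<^sup>+\<omega>. q (V k \<omega>) (uhat k \<omega>) \<partial>M)"
      unfolding Q_def q_def using k by (intro nn_integral_cong) (simp add: zhat_V)
    also have "\<dots> = (\<integral>\<^sup>+\<omega>. (\<integral>\<^sup>+v. q (V k \<omega>) v \<partial>P) \<partial>M)"
      by (rule fresh_uhat[OF k]) measurable
    finally have Q_k: "Q k = \<dots>" .
    have "D (Suc k) + ennreal c * Q k
        = (\<integral>\<^sup>+\<omega>. (\<integral>\<^sup>+v. (\<integral>\<^sup>+w. \<psi> (V k \<omega>) v w \<partial>P) \<partial>P) + ennreal c * (\<integral>\<^sup>+v. q (V k \<omega>) v \<partial>P) \<partial>M)"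
      unfolding D_Suc Q_k by (subst nn_integral_add) (auto simp: nn_integral_cmult)
    also have "\<dots> \<le> (\<integral>\<^sup>+\<omega>. ennreal ((norm (V k \<omega> - zstar))\<^sup>2 + err) \<partial>M)"
      unfolding \<psi>_def q_def by (intro nn_integral_mono expected_descent)
    also have "\<dots> = D k + ennreal err"
      unfolding D_def using err_nonneg
      by (subst ennreal_plus) (auto simp: nn_integral_add M.emeasure_space_1)
    finally show ?thesis .
  qed
  \<comment> \<open>The distance term is kept on the left for the induction and dropped at the
    end.\<close>
  have "D (Suc n) + ennreal c * (\<Sum>k\<le>n. Q k) \<le> ennreal ((norm (z0 - zstar))\<^sup>2 + (real n + 1) * err)" if "n \<le> N" for n
    using that
  proof (induction n)
    case 0
    have "D 0 = ennreal ((norm (z0 - zstar))\<^sup>2)"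
      by (simp add: D_def V_def M.emeasure_space_1)
    with step[of 0] err_nonneg show ?case by simp
  next
    case (Suc n)
    have "D (Suc (Suc n)) + ennreal c * (\<Sum>k\<le>Suc n. Q k)
        = (D (Suc (Suc n)) + ennreal c * Q (Suc n)) + ennreal c * (\<Sum>k\<le>n. Q k)"
      by (simp add: algebra_simps)
    also have "\<dots> \<le> (D (Suc n) + ennreal err) + ennreal c * (\<Sum>k\<le>n. Q k)"
      using Suc.prems by (intro add_mono step) auto
    also have "\<dots> = (D (Suc n) + ennreal c * (\<Sum>k\<le>n. Q k)) + ennreal err"
      by (simp add: algebra_simps)
    also have "\<dots> \<le> ennreal ((norm (z0 - zstar))\<^sup>2 + (real n + 1) * err) + ennreal err"
      using Suc by (intro add_mono) auto
    also have "\<dots> = ennreal ((norm (z0 - zstar))\<^sup>2 + (real (Suc n) + 1) * err)"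
      using err_nonneg by (subst ennreal_plus[symmetric]) (auto simp: algebra_simps)
    finally show ?case .
  qed
  from order_trans[OF _ this[of N]] show "ennreal c * (\<Sum>k\<le>N. \<integral>\<^sup>+\<omega>. ennreal ((norm (m (zhat k \<omega>)))\<^sup>2) \<partial>M)
      \<le> ennreal ((norm (z0 - zstar))\<^sup>2 + (real N + 1) * err)"
    unfolding Q_def by (simp add: add_increasing)
qed

text \<open>Passes from \<open>m\<close> to a nearby operator at the price of a factor 2, and from
  extended nonnegative to real integrals.\<close>

corollary expected_nearby_operator_sum_bound:
  fixes M :: "'w measure" and u uhat z zhat :: "nat \<Rightarrow> 'w \<Rightarrow> 'a" and N :: nat and F :: "'a \<Rightarrow> 'a"
  assumes "prob_space M"
    and "\<And>k. k \<le> N \<Longrightarrow> distr M borel (uhat k) = P" "\<And>k. k \<le> N \<Longrightarrow> distr M borel (u k) = P"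
    and "prob_space.indep_vars M (\<lambda>_. borel) (case_sum uhat u) ({..N} <+> {..N})"
    and "\<And>\<omega>. \<omega> \<in> space M \<Longrightarrow> z 0 \<omega> = z0"
    and "\<And>k \<omega>. k \<le> N \<Longrightarrow> \<omega> \<in> space M \<Longrightarrow> zhat k \<omega> = z k \<omega> - h1 *\<^sub>R G (z k \<omega>) (uhat k \<omega>)"
    and "\<And>k \<omega>. k \<le> N \<Longrightarrow> \<omega> \<in> space M \<Longrightarrow> z (Suc k) \<omega> = z k \<omega> - h2 *\<^sub>R G (zhat k \<omega>) (u k \<omega>)"
    and F [measurable]: "F \<in> borel_measurable borel" and F_m: "\<And>z. (norm (F z - m z))\<^sup>2 \<le> b2"
  shows "c * (\<Sum>k\<le>N. \<integral>\<omega>. (norm (F (zhat k \<omega>)))\<^sup>2 \<partial>M)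
      \<le> 2 * (norm (z0 - zstar))\<^sup>2 + 2 * (real N + 1) * (err + c * b2)"
proof -
  interpret M: prob_space M by fact
  note bound = expected_operator_sum_bound[OF assms(1-7)]
  have b2: "0 \<le> b2" using order_trans[OF zero_le_power2 F_m] .
  let ?Q = "\<lambda>k. \<integral>\<^sup>+\<omega>. ennreal ((norm (m (zhat k \<omega>)))\<^sup>2) \<partial>M"
  have le: "ennreal (\<integral>\<omega>. (norm (F (zhat k \<omega>)))\<^sup>2 \<partial>M) \<le> 2 * ?Q k + ennreal (2 * b2)" if "k \<le> N" for k
  proof -
    have [measurable]: "zhat k \<in> borel_measurable M" using bound(2) that by auto
    \<comment> \<open>Valid without knowing integrability, since the left integral is 0 by
      convention in the divergent case.\<close>
    have "ennreal (\<integral>\<omega>. (norm (F (zhat k \<omega>)))\<^sup>2 \<partial>M) \<le> (\<integral>\<^sup>+\<omega>. ennreal ((norm (F (zhat k \<omega>)))\<^sup>2) \<partial>M)"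
      by (subst integral_eq_nn_integral) (auto simp: ennreal_enn2real_if)
    also have "\<dots> \<le> (\<integral>\<^sup>+\<omega>. 2 * ennreal ((norm (m (zhat k \<omega>)))\<^sup>2) + ennreal (2 * b2) \<partial>M)"
    proof (rule nn_integral_mono)
      fix \<omega>
      let ?y = "zhat k \<omega>"
      have "(norm (F ?y))\<^sup>2 \<le> (norm (m ?y) + norm (F ?y - m ?y))\<^sup>2"
        using norm_triangle_ineq[of "m ?y" "F ?y - m ?y"] by (intro power_mono) auto
      also have "\<dots> \<le> 2 * (norm (m ?y))\<^sup>2 + 2 * (norm (F ?y - m ?y))\<^sup>2"
        using sum_squares_bound[of "norm (m ?y)" "norm (F ?y - m ?y)"] by (simp add: power2_sum)
      also have "\<dots> \<le> 2 * (norm (m ?y))\<^sup>2 + 2 * b2"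
        using F_m[of ?y] by simp
      finally have "ennreal ((norm (F ?y))\<^sup>2) \<le> ennreal (2 * (norm (m ?y))\<^sup>2 + 2 * b2)"
        by (rule ennreal_leI)
      also have "\<dots> = 2 * ennreal ((norm (m ?y))\<^sup>2) + ennreal (2 * b2)"
        using b2 by (simp add: ennreal_mult)
      finally show "ennreal ((norm (F ?y))\<^sup>2) \<le> 2 * ennreal ((norm (m ?y))\<^sup>2) + ennreal (2 * b2)" .
    qed
    also have "\<dots> = 2 * ?Q k + ennreal (2 * b2)"
      by (simp add: nn_integral_add nn_integral_cmult M.emeasure_space_1)
    finally show ?thesis .
  qed
  have "ennreal (c * (\<Sum>k\<le>N. \<integral>\<omega>. (norm (F (zhat k \<omega>)))\<^sup>2 \<partial>M))
      = ennreal c * (\<Sum>k\<le>N. ennreal (\<integral>\<omega>. (norm (F (zhat k \<omega>)))\<^sup>2 \<partial>M))"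
    using c by (simp add: ennreal_mult'' ennreal_mult sum_nonneg)
  also have "\<dots> \<le> ennreal c * (\<Sum>k\<le>N. 2 * ?Q k + ennreal (2 * b2))"
    using le by (intro mult_left_mono sum_mono) auto
  also have "\<dots> = 2 * (ennreal c * (\<Sum>k\<le>N. ?Q k)) + ennreal c * ((real N + 1) * ennreal (2 * b2))"
    by (simp add: sum.distrib sum_distrib_left[symmetric] distrib_left mult.left_commute
        ennreal_of_nat_eq_real_of_nat add.commute)
  also have "\<dots> \<le> 2 * ennreal ((norm (z0 - zstar))\<^sup>2 + (real N + 1) * err) + ennreal c * ((real N + 1) * ennreal (2 * b2))"
    by (intro add_mono mult_left_mono bound(1)) auto
  also have "\<dots> = ennreal (2 * ((norm (z0 - zstar))\<^sup>2 + (real N + 1) * err) + c * ((real N + 1) * (2 * b2)))"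
  proof -
    have "0 \<le> 2 * ((norm (z0 - zstar))\<^sup>2 + (real N + 1) * err)" "0 \<le> c * ((real N + 1) * (2 * b2))"
      using err_nonneg b2 c by simp_all
    then show ?thesis using err_nonneg b2 c(1)
      by (subst ennreal_plus) (simp_all add: ennreal_mult)
  qed
  finally show ?thesis
    using err_nonneg b2 c by (subst (asm) ennreal_le_iff) (auto simp: algebra_simps)
qed

end

section \<open>Gaussian smoothing of the saddle operator\<close>

text \<open>Riesz representation: the derivative is the inner product with the vector of its values
  on the basis.\<close>

lemma GDERIV_grad:
  fixes f :: "'a::euclidean_space \<Rightarrow> real"
  assumes "f differentiable (at x)"
  shows "GDERIV f x :> grad f x"
proof -
  obtain D where D: "(f has_derivative D) (at x)" using assms by (auto simp: differentiable_def)
  interpret D: bounded_linear D using D by (rule has_derivative_bounded_linear)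
  have "D h = inner h (\<Sum>b\<in>Basis. D b *\<^sub>R b)" for h
  proof -
    have "D h = D (\<Sum>b\<in>Basis. inner h b *\<^sub>R b)" by (simp add: euclidean_representation)
    also have "\<dots> = inner h (\<Sum>b\<in>Basis. D b *\<^sub>R b)"
      by (simp add: D.sum D.scaleR inner_sum_right mult.commute)
    finally show ?thesis .
  qed
  then have "D = (\<lambda>h. inner h (\<Sum>b\<in>Basis. D b *\<^sub>R b))" by blast
  with D have "GDERIV f x :> (\<Sum>b\<in>Basis. D b *\<^sub>R b)" by (simp add: gderiv_def)
  with grad_eqI[OF this] show ?thesis by simp
qed

text \<open>A self-adjoint isometry that carries the gradient to the saddle operator and the
  Gaussian direction to the oracle direction, so one map accounts for all sign changes.\<close>

definition reflect :: "'a::real_inner \<times> 'b::real_inner \<Rightarrow> 'a \<times> 'b" where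
  "reflect z = (fst z, - snd z)"

lemma norm_reflect [simp]: "norm (reflect z) = norm z"
  by (simp add: reflect_def norm_prod_def)

lemma reflect_diff: "reflect (z - w) = reflect z - reflect w"
  by (simp add: reflect_def)

lemma inner_reflect_left: "inner (reflect z) w = inner z (reflect w)"
  by (simp add: reflect_def inner_prod_def)

text \<open>Chain rule along the two affine embeddings that freeze one block of variables.\<close>

lemma saddle_op_eq_reflect_grad:
  fixes f :: "'a::euclidean_space \<times> 'b::euclidean_space \<Rightarrow> real"
  assumes "GDERIV f z :> g"
  shows "saddle_op f z = reflect g"
proof -
  have "GDERIV (\<lambda>x. f (x, snd z)) (fst z) :> fst g"
    unfolding gderiv_def
    by (rule has_derivative_eq_rhs[OF has_derivative_compose[where f = "\<lambda>x. (x, snd z)" and g = f]])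
      (use assms in \<open>auto intro!: derivative_eq_intros simp: gderiv_def inner_prod_def\<close>)
  moreover have "GDERIV (\<lambda>y. f (fst z, y)) (snd z) :> snd g"
    unfolding gderiv_def
    by (rule has_derivative_eq_rhs[OF has_derivative_compose[where f = "\<lambda>y. (fst z, y)" and g = f]])
      (use assms in \<open>auto intro!: derivative_eq_intros simp: gderiv_def inner_prod_def\<close>)
  ultimately show ?thesis by (simp add: saddle_op_def grad_eqI reflect_def)
qed

lemma zo_oracle_eq_reflect:
  "zo_oracle lam \<mu> f z u = (lam * ((f (z + \<mu> *\<^sub>R u) - f z) / \<mu>)) *\<^sub>R reflect u"
  by (simp add: zo_oracle_def reflect_def)

lemma normB_dual_sq: "lam > 0 \<Longrightarrow> (normB_dual lam z)\<^sup>2 = (norm z)\<^sup>2 / lam"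
  by (simp add: normB_dual_def power2_norm_eq_inner field_simps)

lemma normB_dual_eq: "lam > 0 \<Longrightarrow> normB_dual lam z = norm z / sqrt lam"
  by (simp add: normB_dual_def norm_eq_sqrt_inner real_sqrt_mult real_sqrt_inverse divide_inverse mult.commute)

lemma normB_eq: "lam > 0 \<Longrightarrow> normB lam z = sqrt lam * norm z"
  by (simp add: normB_def norm_eq_sqrt_inner real_sqrt_mult)

section \<open>The mean of the zeroth-order oracle\<close>

locale smooth_saddle =
  fixes f :: "'a::euclidean_space \<times> 'b::euclidean_space \<Rightarrow> real"
    and lam \<mu> L :: real
  assumes lam: "lam > 0" and \<mu>: "\<mu> > 0" and L: "0 \<le> L"
    and f_differentiable: "\<And>w. f differentiable (at w)"
    and grad_lipschitz: "\<And>z w. norm (grad f z - grad f w) \<le> L * norm (z - w)"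
begin

sublocale P: prob_space "gauss lam :: ('a \<times> 'b) measure"
  by (rule prob_space_gauss[OF lam])

abbreviation F :: "'a \<times> 'b \<Rightarrow> 'a \<times> 'b" where "F \<equiv> saddle_op f"
abbreviation G :: "'a \<times> 'b \<Rightarrow> 'a \<times> 'b \<Rightarrow> 'a \<times> 'b" where "G \<equiv> zo_oracle lam \<mu> f"

text \<open>Averaging \<open>F\<close> itself makes the Lipschitz bound and the closeness to
  \<open>F\<close> direct; \<open>G_mean\<close> identifies the result with the oracle mean.\<close>

definition mean_op :: "'a \<times> 'b \<Rightarrow> 'a \<times> 'b" where
  "mean_op z = (\<integral>u. F (z + \<mu> *\<^sub>R u) \<partial>gauss lam)"

definition smoothing_err :: real where
  "smoothing_err = L\<^sup>2 * \<mu>\<^sup>2 * DIM('a \<times> 'b) / lam"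

lemma F_eq: "F z = reflect (grad f z)"
  by (rule saddle_op_eq_reflect_grad[OF GDERIV_grad[OF f_differentiable]])

lemma F_lipschitz: "norm (F z - F w) \<le> L * norm (z - w)"
  using grad_lipschitz by (simp add: F_eq reflect_diff[symmetric])

lemma F_shift_bound: "norm (F (z + \<mu> *\<^sub>R u) - F z) \<le> L * \<mu> * norm u"
  using F_lipschitz[of "z + \<mu> *\<^sub>R u" z] \<mu> by simp

lemma continuous_F: "continuous_on UNIV F" and continuous_grad: "continuous_on UNIV (grad f)"
  unfolding atomize_conj
  by (intro conjI lipschitz_on_continuous_on[of L] lipschitz_onI L; unfold dist_norm)
    (rule F_lipschitz grad_lipschitz)+

lemma F_measurable [measurable]: "F \<in> borel_measurable borel"
  by (rule borel_measurable_continuous_onI[OF continuous_F])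

lemma f_measurable [measurable]: "f \<in> borel_measurable borel"
  by (intro borel_measurable_continuous_onI continuous_at_imp_continuous_on ballI
      differentiable_imp_continuous_within f_differentiable)

lemma reflect_measurable [measurable]: "reflect \<in> borel_measurable (borel :: ('a \<times> 'b) measure)"
  unfolding reflect_def by (intro borel_measurable_continuous_onI continuous_intros)

lemma G_measurable: "case_prod G \<in> borel_measurable (borel \<Otimes>\<^sub>M borel)"
  unfolding zo_oracle_eq_reflect by measurable

lemma G_measurable2 [measurable]: "G z \<in> borel_measurable borel"
  unfolding zo_oracle_eq_reflect by measurable

lemma poly_growth_grad_shift: "poly_growth (\<lambda>u. grad f (z + \<mu> *\<^sub>R u))"
proof (rule poly_growth_mono)
  show "poly_growth (\<lambda>u. norm (grad f z) + L * \<mu> * norm (u :: 'a \<times> 'b))"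
    by (intro poly_growth_intros)
  fix u
  have "norm (grad f (z + \<mu> *\<^sub>R u)) \<le> norm (grad f z) + norm (grad f (z + \<mu> *\<^sub>R u) - grad f z)"
    using norm_triangle_ineq[of "grad f z" "grad f (z + \<mu> *\<^sub>R u) - grad f z"] by simp
  then show "norm (grad f (z + \<mu> *\<^sub>R u)) \<le> norm (norm (grad f z) + L * \<mu> * norm u)"
    using grad_lipschitz[of "z + \<mu> *\<^sub>R u" z] \<mu> by simp
qed

lemma poly_growth_F_shift: "poly_growth (\<lambda>u. F (z + \<mu> *\<^sub>R u))"
  using poly_growth_grad_shift[of z] by (rule poly_growth_mono) (simp add: F_eq)

text \<open>Mean value inequality on the ball of radius \<open>norm w\<close>, where the gradient is
  bounded by its value at the centre plus its Lipschitz variation. It supplies polynomial growth of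
  the difference quotient.\<close>

lemma f_increment_bound: "\<bar>f (z + w) - f z\<bar> \<le> (norm (grad f z) + L * norm w) * norm w"
proof -
  have "norm (f (z + w) - f z) \<le> (norm (grad f z) + L * norm w) * norm (z + w - z)"
  proof (rule differentiable_bound[where S = "cball z (norm w)" and f' = "\<lambda>x h. inner h (grad f x)"])
    fix x assume x: "x \<in> cball z (norm w)"
    show "(f has_derivative (\<lambda>h. inner h (grad f x))) (at x within cball z (norm w))"
      using GDERIV_grad[OF f_differentiable] unfolding gderiv_def by (rule has_derivative_at_withinI)
    show "onorm (\<lambda>h. inner h (grad f x)) \<le> norm (grad f z) + L * norm w"
    proof (rule onorm_le)
      fix h
      have "norm (grad f x) \<le> norm (grad f z) + norm (grad f x - grad f z)"
        using norm_triangle_ineq[of "grad f z" "grad f x - grad f z"] by simp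
      also have "norm (grad f x - grad f z) \<le> L * norm w"
        using x by (intro order_trans[OF grad_lipschitz] mult_left_mono L) (simp add: dist_norm norm_minus_commute)
      finally have grad_x: "norm (grad f x) \<le> norm (grad f z) + L * norm w" by simp
      have "\<bar>inner h (grad f x)\<bar> \<le> norm (grad f x) * norm h"
        using Cauchy_Schwarz_ineq2[of h "grad f x"] by (simp only: mult.commute)
      also have "\<dots> \<le> (norm (grad f z) + L * norm w) * norm h"
        by (rule mult_right_mono[OF grad_x]) simp
      finally show "norm (inner h (grad f x)) \<le> (norm (grad f z) + L * norm w) * norm h"
        by simp
    qed
  qed (auto simp: dist_norm)
  then show ?thesis by simp
qed

lemma poly_growth_difference_quotient: "poly_growth (\<lambda>u. (f (z + \<mu> *\<^sub>R u) - f z) / \<mu>)"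
proof (rule poly_growth_mono)
  show "poly_growth (\<lambda>u. (norm (grad f z) + L * \<mu> * norm u) * norm (u :: 'a \<times> 'b))"
    by (intro poly_growth_intros)
  fix u
  show "norm ((f (z + \<mu> *\<^sub>R u) - f z) / \<mu>) \<le> norm ((norm (grad f z) + L * \<mu> * norm u) * norm u)"
    using f_increment_bound[of z "\<mu> *\<^sub>R u"] \<mu> L by (simp add: abs_mult field_simps)
qed

lemma poly_growth_G: "poly_growth (G z)"
proof -
  have "poly_growth (\<lambda>u. reflect (u :: 'a \<times> 'b))"
    using poly_growth_id by (rule poly_growth_mono) simp
  then have "poly_growth (\<lambda>u. (lam * ((f (z + \<mu> *\<^sub>R u) - f z) / \<mu>)) *\<^sub>R reflect u)"
    by (intro poly_growth_scaleR poly_growth_mult poly_growth_const poly_growth_difference_quotient)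
  then show ?thesis by (simp add: zo_oracle_eq_reflect[abs_def])
qed

lemma G_integrable: "integrable (gauss lam) (G z)"
  and G_sq_integrable: "integrable (gauss lam) (\<lambda>u. (norm (G z u))\<^sup>2)"
  by (intro integrable_gauss_poly_growth lam poly_growth_power poly_growth_norm poly_growth_G; measurable)+

lemma F_shift_integrable: "integrable (gauss lam) (\<lambda>u. F (z + \<mu> *\<^sub>R u))"
  and F_shift_sq_integrable: "integrable (gauss lam) (\<lambda>u. (norm (F (z + \<mu> *\<^sub>R u)))\<^sup>2)"
  by (intro integrable_gauss_poly_growth lam poly_growth_power poly_growth_norm poly_growth_F_shift; measurable)+

text \<open>Integration by parts applied to the difference quotient in the direction
  \<open>reflect b\<close>: the chain rule produces a factor \<open>\<mu>\<close> that cancels the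
  denominator.\<close>

lemma G_mean: "(\<integral>u. G z u \<partial>gauss lam) = mean_op z"
proof (rule euclidean_eqI)
  fix b :: "'a \<times> 'b"
  let ?h = "\<lambda>u. (f (z + \<mu> *\<^sub>R u) - f z) / \<mu>"
  have deriv: "GDERIV ?h u :> grad f (z + \<mu> *\<^sub>R u)" for u
  proof -
    have "((\<lambda>u. f (z + \<mu> *\<^sub>R u)) has_derivative (\<lambda>h. inner (\<mu> *\<^sub>R h) (grad f (z + \<mu> *\<^sub>R u)))) (at u)"
      using GDERIV_grad[OF f_differentiable] unfolding gderiv_def
      by (rule has_derivative_compose[rotated]) (auto intro!: derivative_eq_intros)
    then show ?thesis unfolding gderiv_def using \<mu>
      by (auto intro!: derivative_eq_intros)
  qed
  have "inner (\<integral>u. G z u \<partial>gauss lam) b = (\<integral>u. inner (G z u) b \<partial>gauss lam)"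
    using G_integrable by (simp add: integral_inner_left)
  also have "\<dots> = (\<integral>u. lam * inner u (reflect b) * ?h u \<partial>gauss lam)"
    by (simp add: zo_oracle_eq_reflect inner_reflect_left mult_ac)
  also have "\<dots> = (\<integral>u. inner (grad f (z + \<mu> *\<^sub>R u)) (reflect b) \<partial>gauss lam)"
    by (intro gauss_integration_by_parts lam deriv poly_growth_difference_quotient poly_growth_grad_shift
        continuous_on_compose2[OF continuous_grad] continuous_intros) auto
  also have "\<dots> = (\<integral>u. inner (F (z + \<mu> *\<^sub>R u)) b \<partial>gauss lam)"
    by (simp add: F_eq inner_reflect_left)
  also have "\<dots> = inner (mean_op z) b"
    using F_shift_integrable by (simp add: mean_op_def integral_inner_left)
  finally show "inner (\<integral>u. G z u \<partial>gauss lam) b = inner (mean_op z) b" .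
qed

text \<open>Lets the hypothesis on the deviation from the operator of the smoothed function, taken
  as the centre \<open>a\<close>, serve as a variance bound.\<close>

lemma variance_le_deviation:
  "(\<integral>u. (norm (G z u - mean_op z))\<^sup>2 \<partial>gauss lam) \<le> (\<integral>u. (norm (G z u - a))\<^sup>2 \<partial>gauss lam)"
  unfolding P.expectation_norm_diff_sq(2)[OF G_integrable G_sq_integrable, of z a] G_mean by simp

lemma mean_op_lipschitz: "norm (mean_op z - mean_op w) \<le> L * norm (z - w)"
proof -
  have "mean_op z - mean_op w = (\<integral>u. F (z + \<mu> *\<^sub>R u) - F (w + \<mu> *\<^sub>R u) \<partial>gauss lam)"
    unfolding mean_op_def by (simp add: F_shift_integrable)
  also have "norm \<dots> \<le> (\<integral>u. norm (F (z + \<mu> *\<^sub>R u) - F (w + \<mu> *\<^sub>R u)) \<partial>(gauss lam :: ('a \<times> 'b) measure))"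
    by (rule integral_norm_bound)
  also have "\<dots> \<le> (\<integral>u. L * norm (z - w) \<partial>(gauss lam :: ('a \<times> 'b) measure))"
  proof (rule integral_mono)
    show "norm (F (z + \<mu> *\<^sub>R u) - F (w + \<mu> *\<^sub>R u)) \<le> L * norm (z - w)" for u
      using F_lipschitz[of "z + \<mu> *\<^sub>R u" "w + \<mu> *\<^sub>R u"] by simp
  qed (auto simp: F_shift_integrable)
  finally show ?thesis using P.prob_space by simp
qed

lemma F_shift_deviation: "(\<integral>u. (norm (F (z + \<mu> *\<^sub>R u) - F z))\<^sup>2 \<partial>gauss lam) \<le> smoothing_err"
proof -
  have "(\<integral>u. (norm (F (z + \<mu> *\<^sub>R u) - F z))\<^sup>2 \<partial>gauss lam) \<le> (\<integral>u. (L * \<mu>)\<^sup>2 * (norm u)\<^sup>2 \<partial>(gauss lam :: ('a \<times> 'b) measure))"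
  proof (rule integral_mono)
    show "(norm (F (z + \<mu> *\<^sub>R u) - F z))\<^sup>2 \<le> (L * \<mu>)\<^sup>2 * (norm u)\<^sup>2" for u
      unfolding power_mult_distrib[symmetric] by (intro power_mono F_shift_bound) simp
    show "integrable (gauss lam) (\<lambda>u::'a \<times> 'b. (L * \<mu>)\<^sup>2 * (norm u)\<^sup>2)"
      by (intro integrable_gauss_poly_growth lam poly_growth_intros; measurable)
  qed (rule P.expectation_norm_diff_sq(1)[OF F_shift_integrable F_shift_sq_integrable])
  also have "\<dots> = smoothing_err"
    using gauss_second_moment[OF lam, where ?'a = "'a \<times> 'b"]
    by (simp add: smoothing_err_def power_mult_distrib)
  finally show ?thesis .
qed

text \<open>Bias-variance decomposition of \<open>F (z + \<mu> *\<^sub>R u)\<close>: about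
  \<open>F z\<close> the sum of variance and squared bias is at most \<open>smoothing_err\<close>,
  so each part is; about 0 it gives the second moment.\<close>

lemma
  shows mean_op_near_F: "(norm (F z - mean_op z))\<^sup>2 \<le> smoothing_err"
    and F_shift_second_moment: "(\<integral>u. (norm (F (z + \<mu> *\<^sub>R u)))\<^sup>2 \<partial>gauss lam) \<le> (norm (mean_op z))\<^sup>2 + smoothing_err"
proof -
  let ?X = "\<lambda>u. F (z + \<mu> *\<^sub>R u)"
  let ?V = "(\<integral>u. (norm (?X u - mean_op z))\<^sup>2 \<partial>gauss lam)"
  note decomp = P.expectation_norm_diff_sq(2)[OF F_shift_integrable F_shift_sq_integrable, of z, folded mean_op_def]
  have V: "?V + (norm (mean_op z - F z))\<^sup>2 \<le> smoothing_err"
    using F_shift_deviation[of z] unfolding decomp[of "F z"] .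
  have "0 \<le> ?V" by (rule Bochner_Integration.integral_nonneg) simp
  with V show "(norm (F z - mean_op z))\<^sup>2 \<le> smoothing_err" unfolding norm_minus_commute[of "F z"] by linarith
  have "?V \<le> smoothing_err" using V zero_le_power2[of "norm (mean_op z - F z)"] by linarith
  then show "(\<integral>u. (norm (?X u))\<^sup>2 \<partial>gauss lam) \<le> (norm (mean_op z))\<^sup>2 + smoothing_err"
    using decomp[of 0] by simp
qed

text \<open>The inequality for \<open>F\<close> is averaged over the shifted points. In the extra
  term, \<open>F (z + \<mu> *\<^sub>R u)\<close> is compared with \<open>F z\<close>, whose product
  with \<open>u\<close> has mean zero; this makes the error quadratic in
  \<open>\<mu>\<close>.\<close>

lemma mean_op_weak_minty:
  assumes \<kappa>: "0 \<le> \<kappa>" and minty: "\<And>w. - \<kappa> * (norm (F w))\<^sup>2 \<le> inner (F w) (w - zstar)"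
  shows "- \<kappa> * (norm (mean_op z))\<^sup>2 - (\<kappa> * smoothing_err + L * \<mu>\<^sup>2 * DIM('a \<times> 'b) / lam)
    \<le> inner (mean_op z) (z - zstar)"
proof -
  let ?P = "gauss lam :: ('a \<times> 'b) measure" and ?X = "\<lambda>u. F (z + \<mu> *\<^sub>R u)"
  have sq_int: "integrable ?P (\<lambda>u. (norm u)\<^sup>2)"
    by (intro integrable_gauss_poly_growth lam poly_growth_intros; measurable)
  have lin_int: "integrable ?P (\<lambda>u. inner u b)" for b
    by (intro integrable_gauss_poly_growth lam poly_growth_intros; measurable)
  have pt: "- \<kappa> * (norm (?X u))\<^sup>2 - L * \<mu>\<^sup>2 * (norm u)\<^sup>2 - \<mu> * inner u (F z) \<le> inner (?X u) (z - zstar)" for u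
  proof -
    have "inner (?X u - F z) u \<le> norm (?X u - F z) * norm u"
      using Cauchy_Schwarz_ineq2[of "?X u - F z" u] by simp
    also have "\<dots> \<le> L * \<mu> * norm u * norm u"
      by (intro mult_right_mono F_shift_bound) simp
    finally have "\<mu> * inner (?X u - F z) u \<le> \<mu> * (L * \<mu> * norm u * norm u)"
      using \<mu> by (intro mult_left_mono) auto
    then have "\<mu> * inner (?X u) u - \<mu> * inner u (F z) \<le> L * \<mu>\<^sup>2 * (norm u)\<^sup>2"
      by (simp add: inner_diff_left inner_commute[of "F z"] power2_eq_square algebra_simps)
    moreover have "inner (?X u) (z + \<mu> *\<^sub>R u - zstar) = inner (?X u) (z - zstar) + \<mu> * inner (?X u) u"
      by (simp add: inner_diff_right inner_add_right)
    ultimately show ?thesis using minty[of "z + \<mu> *\<^sub>R u"] by linarith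
  qed
  \<comment> \<open>The second moment of \<open>F\<close> is replaced by its upper bound, which is
    sound because its coefficient \<open>- \<kappa>\<close> is nonpositive; the trailing 0 is the
    Gaussian mean.\<close>
  have "- \<kappa> * ((norm (mean_op z))\<^sup>2 + smoothing_err) - L * \<mu>\<^sup>2 * (DIM('a \<times> 'b) / lam) - \<mu> * 0
      \<le> - \<kappa> * (\<integral>u. (norm (?X u))\<^sup>2 \<partial>?P) - L * \<mu>\<^sup>2 * (\<integral>u. (norm u)\<^sup>2 \<partial>?P) - \<mu> * (\<integral>u. inner u (F z) \<partial>?P)"
    using mult_left_mono[OF F_shift_second_moment \<kappa>, of z]
    by (simp add: gauss_second_moment[OF lam] gauss_mean_0[OF lam])
  also have "\<dots> = (\<integral>u. - \<kappa> * (norm (?X u))\<^sup>2 - L * \<mu>\<^sup>2 * (norm u)\<^sup>2 - \<mu> * inner u (F z) \<partial>?P)"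
    using F_shift_sq_integrable[of z] sq_int lin_int by simp
  also have "\<dots> \<le> (\<integral>u. inner (?X u) (z - zstar) \<partial>?P)"
    by (rule integral_mono[OF _ _ pt]) (use F_shift_sq_integrable[of z] F_shift_integrable[of z] sq_int lin_int in auto)
  also have "\<dots> = inner (mean_op z) (z - zstar)"
    using F_shift_integrable[of z] by (simp add: mean_op_def integral_inner_left)
  finally show ?thesis by (simp add: algebra_simps)
qed

end

section \<open>Parameter choice\<close>

text \<open>The third claim bounds the decrease constant from below: \<open>h2 \<le> h1 / 2\<close>
  makes \<open>h1 * h2 - h2^2\<close> at least \<open>h2^2\<close>, and the upper bound on
  \<open>h2\<close> absorbs the term with \<open>\<rho>\<close>.\<close>

lemma step_size_bounds:
  fixes lam L1 \<rho> h1 h2 :: real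
  assumes lam: "lam > 0" and L1: "L1 > 0" and rho: "0 \<le> \<rho>"
    and h1: "h1 \<le> 1 / (L1 * lam)"
    and h2: "h2 > 0" "sqrt (2 * \<rho> / (L1 * lam\<^sup>2)) < h2" "h2 \<le> h1 / 2"
  shows "0 < lam\<^sup>2 * L1 * h2\<^sup>2 - 2 * \<rho>"
    and "h2 \<le> 1 / (2 * lam * L1)"
    and "(lam\<^sup>2 * L1 * h2\<^sup>2 - 2 * \<rho>) / (lam\<^sup>2 * L1) \<le> h1 * h2 - h2\<^sup>2 - h2 * \<rho> / lam"
    and "lam\<^sup>2 * L1 * h2\<^sup>2 - 2 * \<rho> \<le> 1 / (4 * L1)"
    and "2 * (3 * h1 * h2 + h2\<^sup>2) \<le> 6 / (lam\<^sup>2 * L1\<^sup>2)"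
proof -
  have "2 * \<rho> / (L1 * lam\<^sup>2) < h2\<^sup>2"
    using h2 rho L1 real_less_lsqrt real_sqrt_less_iff[of "2 * \<rho> / (L1 * lam\<^sup>2)" "h2\<^sup>2"] by simp
  then show pos: "0 < lam\<^sup>2 * L1 * h2\<^sup>2 - 2 * \<rho>"
    using lam L1 by (simp add: field_simps)
  have h2': "h2 \<le> 1 / (2 * lam * L1)" using h1 h2(3) by (simp add: field_simps)
  then show "h2 \<le> 1 / (2 * lam * L1)" .
  have sq: "h2\<^sup>2 \<le> 1 / (4 * lam\<^sup>2 * L1\<^sup>2)"
    using power_mono[OF h2', of 2] h2(1) by (simp add: power_divide power_mult_distrib)
  have "h2 * \<rho> / lam \<le> 1 / (2 * lam * L1) * \<rho> / lam"
    using h2' rho lam by (intro divide_right_mono mult_right_mono) auto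
  also have "\<dots> \<le> 2 * \<rho> / (lam\<^sup>2 * L1)"
    using rho lam L1 by (simp add: field_simps power2_eq_square)
  finally have "h2 * \<rho> / lam \<le> 2 * \<rho> / (lam\<^sup>2 * L1)" .
  moreover have "2 * h2\<^sup>2 \<le> h1 * h2"
    using mult_right_mono[of "2 * h2" h1 h2] h2 by (simp add: power2_eq_square)
  moreover have "(lam\<^sup>2 * L1 * h2\<^sup>2 - 2 * \<rho>) / (lam\<^sup>2 * L1) = h2\<^sup>2 - 2 * \<rho> / (lam\<^sup>2 * L1)"
    using lam L1 by (simp add: field_simps)
  moreover have "h2\<^sup>2 - x \<le> h1 * h2 - h2\<^sup>2 - y" if "2 * h2\<^sup>2 \<le> h1 * h2" "y \<le> x" for x y
    using that by linarith
  ultimately show "(lam\<^sup>2 * L1 * h2\<^sup>2 - 2 * \<rho>) / (lam\<^sup>2 * L1) \<le> h1 * h2 - h2\<^sup>2 - h2 * \<rho> / lam"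
    by metis
  have "lam\<^sup>2 * L1 * h2\<^sup>2 \<le> lam\<^sup>2 * L1 * (1 / (4 * lam\<^sup>2 * L1\<^sup>2))"
    using sq L1 by (intro mult_left_mono) auto
  also have "\<dots> = 1 / (4 * L1)" using lam L1 by (simp add: field_simps power2_eq_square)
  finally show "lam\<^sup>2 * L1 * h2\<^sup>2 - 2 * \<rho> \<le> 1 / (4 * L1)" using rho by linarith
  \<comment> \<open>In this unit the left side is at most
    \<open>2 * (3 / 2 + 1 / 4) = 7 / 2\<close>, below the claimed 6.\<close>
  define X where "X = 1 / (lam\<^sup>2 * L1\<^sup>2)"
  have "h1 * h2 \<le> 1 / (L1 * lam) * (1 / (2 * lam * L1))"
    using h1 h2' h2(1) L1 lam by (intro mult_mono) auto
  also have "\<dots> = 1 / 2 * X" by (simp add: X_def power2_eq_square field_simps)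
  finally have "h1 * h2 \<le> 1 / 2 * X" .
  moreover have "h2\<^sup>2 \<le> 1 / 4 * X" using sq by (simp add: X_def field_simps)
  moreover have "0 \<le> X" by (simp add: X_def)
  ultimately have "2 * (3 * (h1 * h2) + h2\<^sup>2) \<le> 6 * X" unfolding distrib_left by linarith
  then show "2 * (3 * h1 * h2 + h2\<^sup>2) \<le> 6 / (lam\<^sup>2 * L1\<^sup>2)" by (simp add: X_def mult.assoc)
qed

text \<open>The first claim controls the distance between the oracle mean and \<open>F\<close>, the
  second the weak Minty defect. Here \<open>A\<close> stands for
  \<open>lam^2 * L1 * h2^2 - 2 * \<rho>\<close>.\<close>

lemma smoothing_parameter_bounds:
  fixes lam L1 \<mu> \<rho> h2 \<epsilon> d A :: real
  assumes lam: "lam > 0" and L1: "L1 > 0" and mu: "\<mu> > 0" and rho: "0 \<le> \<rho>" and d: "d \<ge> 1"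
    and A: "0 < A" "A \<le> 1 / (4 * L1)" and h2: "h2 > 0" "h2 \<le> 1 / (2 * lam * L1)"
    and mu_le: "\<mu> \<le> sqrt (A / (16 * lam * L1 * d + 16 * lam * L1\<^sup>2 * \<rho> * (d + 3) ^ 3)) * \<epsilon>"
  shows "L1\<^sup>2 * lam * \<mu>\<^sup>2 * d \<le> \<epsilon>\<^sup>2 / 64"
    and "4 * h2 * (\<mu>\<^sup>2 * (L1 * d + \<rho> * L1\<^sup>2 * d / 2)) \<le> A / (lam\<^sup>2 * L1) * (\<epsilon>\<^sup>2 / 8)"
proof -
  let ?D = "16 * lam * L1 * d + 16 * lam * L1\<^sup>2 * \<rho> * (d + 3) ^ 3"
  have D: "?D > 0" using lam L1 d rho by (intro add_pos_nonneg mult_pos_pos mult_nonneg_nonneg) auto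
  have "\<mu>\<^sup>2 \<le> (sqrt (A / ?D) * \<epsilon>)\<^sup>2" using mu_le mu by (intro power_mono) auto
  also have "\<dots> = A / ?D * \<epsilon>\<^sup>2" using A(1) D by (simp add: power_mult_distrib)
  finally have muD: "\<mu>\<^sup>2 * ?D \<le> A * \<epsilon>\<^sup>2" using D by (simp add: field_simps)
  have "\<mu>\<^sup>2 * (16 * lam * L1 * d) \<le> \<mu>\<^sup>2 * ?D"
    using lam L1 rho d by (intro mult_left_mono) auto
  with muD have "\<mu>\<^sup>2 * (16 * lam * L1 * d) \<le> A * \<epsilon>\<^sup>2" by linarith
  also have "\<dots> \<le> 1 / (4 * L1) * \<epsilon>\<^sup>2" using A by (intro mult_right_mono) auto
  finally have "\<mu>\<^sup>2 * (16 * lam * L1 * d) * L1 \<le> 1 / (4 * L1) * \<epsilon>\<^sup>2 * L1"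
    using L1 by (intro mult_right_mono) auto
  then show "L1\<^sup>2 * lam * \<mu>\<^sup>2 * d \<le> \<epsilon>\<^sup>2 / 64" using L1 by (simp add: field_simps power2_eq_square)
  \<comment> \<open>Lets the cubic summand of \<open>?D\<close> dominate the linear term with
    \<open>\<rho>\<close> in the defect.\<close>
  have "d \<le> (d + 3) ^ 3"
    using self_le_power[of "d + 3" 3] d by simp
  then have "\<rho> * L1\<^sup>2 * d \<le> L1\<^sup>2 * \<rho> * (d + 3) ^ 3"
    using mult_left_mono[of d "(d + 3) ^ 3" "L1\<^sup>2 * \<rho>"] rho by (simp add: mult_ac)
  moreover have "0 \<le> \<rho> * L1\<^sup>2 * d" using rho d by simp
  ultimately have "\<rho> * L1\<^sup>2 * d / 2 \<le> L1\<^sup>2 * \<rho> * (d + 3) ^ 3" by linarith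
  then have "16 * lam * (L1 * d + \<rho> * L1\<^sup>2 * d / 2) \<le> 16 * lam * (L1 * d + L1\<^sup>2 * \<rho> * (d + 3) ^ 3)"
    using lam by (intro mult_left_mono) auto
  also have "\<dots> = ?D" by (simp add: algebra_simps)
  finally have "16 * lam * (L1 * d + \<rho> * L1\<^sup>2 * d / 2) \<le> ?D" .
  from order_trans[OF mult_left_mono[OF this zero_le_power2] muD]
  have "\<mu>\<^sup>2 * (16 * lam * (L1 * d + \<rho> * L1\<^sup>2 * d / 2)) \<le> A * \<epsilon>\<^sup>2" .
  then have eta: "\<mu>\<^sup>2 * (L1 * d + \<rho> * L1\<^sup>2 * d / 2) \<le> A * \<epsilon>\<^sup>2 / (16 * lam)"
    using lam by (simp add: field_simps)
  have "4 * h2 * (\<mu>\<^sup>2 * (L1 * d + \<rho> * L1\<^sup>2 * d / 2)) \<le> 4 * (1 / (2 * lam * L1)) * (A * \<epsilon>\<^sup>2 / (16 * lam))"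
    using h2 eta lam L1 rho d by (intro mult_mono) auto
  also have "\<dots> = A / (lam\<^sup>2 * L1) * (\<epsilon>\<^sup>2 / 8)" by (simp add: power2_eq_square field_simps)
  finally show "4 * h2 * (\<mu>\<^sup>2 * (L1 * d + \<rho> * L1\<^sup>2 * d / 2)) \<le> A / (lam\<^sup>2 * L1) * (\<epsilon>\<^sup>2 / 8)" .
qed

section \<open>Instantiation of the constants and the error budget\<close>

text \<open>Expectations are taken over the whole of \<open>M\<close>; as \<open>zhat k\<close>
  depends only on samples with index at most \<open>k\<close>, they agree with the expectations over
  those samples. The tagged family makes all samples of both kinds mutually independent.\<close>

theorem corollary3:
  fixes f :: "(real ^ 'n) \<times> (real ^ 'm) \<Rightarrow> real"
    and z0 zstar :: "(real ^ 'n) \<times> (real ^ 'm)"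
    and lam L1 \<mu> \<sigma> \<rho> h1 h2 r0 \<epsilon> :: real
    and d N :: nat
    and M :: "'w measure"
    and u uhat z zhat :: "nat \<Rightarrow> 'w \<Rightarrow> (real ^ 'n) \<times> (real ^ 'm)"
  assumes d: "d = CARD('n) + CARD('m)"
    and lam: "lam > 0"
    and f_diff: "\<And>w. f differentiable (at w)"
    and f_C1: "continuous_on UNIV (grad f)"
    and L1: "L1 > 0"
    and lipschitz: "\<And>z1 z2. normB_dual lam (grad f z1 - grad f z2) \<le> L1 * normB lam (z1 - z2)"
    and mu: "\<mu> > 0"
    and sigma: "\<sigma> \<ge> 0"
    and variance: "\<And>w. (\<integral>v. (normB_dual lam
            (zo_oracle lam \<mu> f w v - saddle_op (smoothing lam \<mu> f) w))\<^sup>2 \<partial>gauss lam) \<le> \<sigma>\<^sup>2"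
    and rho: "0 \<le> \<rho>" "\<rho> < 1 / (8 * L1)"
    and weak_minty: "\<And>w. inner (saddle_op f w) (w - zstar)
            + \<rho> / 2 * (normB_dual lam (saddle_op f w))\<^sup>2 \<ge> 0"
    and h1: "h1 > 0" "h1 \<le> 1 / (L1 * lam)"
    and h2: "h2 > 0" "sqrt (2 * \<rho> / (L1 * lam\<^sup>2)) < h2" "h2 \<le> h1 / 2"
    and prob: "prob_space M"
    and uhat_gauss: "\<And>k. k \<le> N \<Longrightarrow> distributed M lborel (uhat k) (\<lambda>v. ennreal (gauss_density lam v))"
    and u_gauss: "\<And>k. k \<le> N \<Longrightarrow> distributed M lborel (u k) (\<lambda>v. ennreal (gauss_density lam v))"
    and indep: "prob_space.indep_vars M (\<lambda>_. borel) (case_sum uhat u) ({..N} <+> {..N})"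
    and z_init: "\<And>\<omega>. \<omega> \<in> space M \<Longrightarrow> z 0 \<omega> = z0"
    and zhat_step: "\<And>k \<omega>. k \<le> N \<Longrightarrow> \<omega> \<in> space M \<Longrightarrow>
            zhat k \<omega> = z k \<omega> - h1 *\<^sub>R zo_oracle lam \<mu> f (z k \<omega>) (uhat k \<omega>)"
    and z_step: "\<And>k \<omega>. k \<le> N \<Longrightarrow> \<omega> \<in> space M \<Longrightarrow>
            z (Suc k) \<omega> = z k \<omega> - h2 *\<^sub>R zo_oracle lam \<mu> f (zhat k \<omega>) (u k \<omega>)"
    and r0: "r0 = norm (z0 - zstar)"
    and eps: "\<epsilon> > 0"
    and mu_le: "\<mu> \<le> min (\<epsilon> / (sqrt 2 * lam * L1 * (real d + 3) powr (3 / 2)))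
            (sqrt ((lam\<^sup>2 * L1 * h2\<^sup>2 - 2 * \<rho>)
               / (16 * lam * L1 * real d + 16 * lam * L1\<^sup>2 * \<rho> * (real d + 3) ^ 3)) * \<epsilon>)"
    and N_ge: "int N \<ge> \<lceil>(8 * lam\<^sup>2 * L1 * r0\<^sup>2) / (lam\<^sup>2 * L1 * h2\<^sup>2 - 2 * \<rho>) / \<epsilon>\<^sup>2 - 1\<rceil>"
  shows "1 / (real N + 1) * (\<Sum>k=0..N. (\<integral>\<omega>. (norm (saddle_op f (zhat k \<omega>)))\<^sup>2 \<partial>M))
          \<le> \<epsilon>\<^sup>2 + 6 * lam * \<sigma>\<^sup>2 / (lam\<^sup>2 * L1\<^sup>2 * h2\<^sup>2 - 2 * \<rho> * L1)"
proof -
  define A where "A = lam\<^sup>2 * L1 * h2\<^sup>2 - 2 * \<rho>"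
  \<comment> \<open>The two weighted norms each contribute a factor \<open>sqrt lam\<close> to the
    Euclidean Lipschitz constant, and the dual norm turns \<open>\<rho> / 2\<close> into
    \<open>\<kappa>\<close>. \<open>\<eta>\<close> is the defect from
    \<open>mean_op_weak_minty\<close> for these values, and \<open>c\<close> turns its locale
    condition into an equality.\<close>
  define L where "L = L1 * lam"
  define \<kappa> where "\<kappa> = \<rho> / (2 * lam)"
  define \<eta> where "\<eta> = \<mu>\<^sup>2 * (L1 * real d + \<rho> * L1\<^sup>2 * real d / 2)"
  define c where "c = h1 * h2 - h2\<^sup>2 - 2 * h2 * \<kappa>"
  have L: "L > 0" using L1 lam by (simp add: L_def)
  note steps = step_size_bounds[OF lam L1 rho(1) h1(2) h2, folded A_def]
  have c_ge: "A / (lam\<^sup>2 * L1) \<le> c" using steps(3) by (simp add: c_def \<kappa>_def)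
  have A_pos: "0 < A / (lam\<^sup>2 * L1)" using steps(1) lam L1 by simp
  then have c_pos: "0 < c" using c_ge by linarith
  have dim: "DIM((real ^ 'n) \<times> (real ^ 'm)) = d" by (simp add: d)
  have "1 \<le> d" unfolding d using zero_less_card_finite[where 'a = 'n] by linarith
  then have d1: "1 \<le> real d" by simp
  interpret S: smooth_saddle f lam \<mu> L
  proof
    show "norm (grad f z - grad f w) \<le> L * norm (z - w)" for z w
    proof -
      have "norm (grad f z - grad f w) / sqrt lam \<le> L1 * (sqrt lam * norm (z - w))"
        using lipschitz[of z w] lam by (simp add: normB_dual_eq normB_eq)
      then have "norm (grad f z - grad f w) \<le> L1 * (sqrt lam * norm (z - w)) * sqrt lam"
        using lam by (simp add: field_simps)
      also have "\<dots> = L * norm (z - w)" using lam by (simp add: L_def)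
      finally show ?thesis .
    qed
  qed (use lam mu L f_diff in auto)
  have err_eq: "S.smoothing_err = L1\<^sup>2 * lam * \<mu>\<^sup>2 * real d"
    unfolding S.smoothing_err_def dim using lam by (simp add: L_def power2_eq_square)
  note mus = smoothing_parameter_bounds[OF lam L1 mu rho(1) d1 steps(1,4) h2(1) steps(2), of \<epsilon>]
  have mu_le': "\<mu> \<le> sqrt (A / (16 * lam * L1 * real d + 16 * lam * L1\<^sup>2 * \<rho> * (real d + 3) ^ 3)) * \<epsilon>"
    using mu_le by (simp add: A_def)
  interpret E: noisy_extragradient "gauss lam" "zo_oracle lam \<mu> f" S.mean_op zstar z0 L "lam * \<sigma>\<^sup>2" h1 h2 \<kappa> \<eta> c
  proof
    show "(\<lambda>(z, v). zo_oracle lam \<mu> f z v) \<in> borel_measurable (borel \<Otimes>\<^sub>M borel)"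
      by (rule S.G_measurable)
    show "(\<integral>v. (norm (zo_oracle lam \<mu> f z v - S.mean_op z))\<^sup>2 \<partial>gauss lam) \<le> lam * \<sigma>\<^sup>2" for z
    proof -
      have "(\<integral>v. (norm (zo_oracle lam \<mu> f z v - S.mean_op z))\<^sup>2 \<partial>gauss lam)
          \<le> (\<integral>v. (norm (zo_oracle lam \<mu> f z v - saddle_op (smoothing lam \<mu> f) z))\<^sup>2 \<partial>gauss lam)"
        by (rule S.variance_le_deviation)
      also have "\<dots> \<le> lam * \<sigma>\<^sup>2"
        using variance[of z] lam by (simp add: normB_dual_sq field_simps)
      finally show ?thesis .
    qed
    show "- \<kappa> * (norm (S.mean_op z))\<^sup>2 - \<eta> \<le> inner (S.mean_op z) (z - zstar)" for z
    proof -
      have "\<kappa> * S.smoothing_err + L * \<mu>\<^sup>2 * real d / lam = \<eta>"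
        unfolding err_eq unfolding \<eta>_def \<kappa>_def L_def using lam by (simp add: field_simps power2_eq_square)
      moreover have "- \<kappa> * (norm (saddle_op f w))\<^sup>2 \<le> inner (saddle_op f w) (w - zstar)" for w
        using weak_minty[of w] lam by (simp add: normB_dual_sq \<kappa>_def)
      moreover have "0 \<le> \<kappa>" using rho lam by (simp add: \<kappa>_def)
      ultimately show ?thesis
        using S.mean_op_weak_minty[of \<kappa> zstar z, unfolded dim] by simp
    qed
    show "L * h1 \<le> 1" using h1 lam L1 by (simp add: L_def field_simps)
    show "0 \<le> \<eta>" using L1 rho by (simp add: \<eta>_def)
  qed (use S.G_integrable S.G_sq_integrable S.G_mean S.mean_op_lipschitz h1 h2 c_pos L in \<open>auto simp: c_def\<close>)
  have law: "distr M borel X = gauss lam"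
    if "distributed M lborel X (\<lambda>v. ennreal (gauss_density lam v))" for X :: "'w \<Rightarrow> (real ^ 'n) \<times> (real ^ 'm)"
    using distributed_distr_eq_density[OF that] by (simp add: gauss_def cong: distr_cong)
  let ?T = "\<Sum>k\<le>N. (\<integral>\<omega>. (norm (saddle_op f (zhat k \<omega>)))\<^sup>2 \<partial>M)"
  have bound: "c * ?T \<le> 2 * r0\<^sup>2 + 2 * (real N + 1) * (E.err + c * S.smoothing_err)"
    unfolding r0
  proof (rule E.expected_nearby_operator_sum_bound[where F = "saddle_op f" and u = u and uhat = uhat and z = z, OF prob _ _ indep])
    show "distr M borel (uhat k) = gauss lam" "distr M borel (u k) = gauss lam" if "k \<le> N" for k
      using that by (simp_all add: law uhat_gauss u_gauss)
  qed (fact z_init zhat_step z_step S.F_measurable S.mean_op_near_F)+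
  \<comment> \<open>The lower bound on \<open>N\<close> says exactly that the initial distance costs
    at most a quarter of the target.\<close>
  have N: "2 * r0\<^sup>2 \<le> (real N + 1) * (A / (lam\<^sup>2 * L1) * (\<epsilon>\<^sup>2 / 4))"
  proof -
    have "8 * lam\<^sup>2 * L1 * r0\<^sup>2 / A / \<epsilon>\<^sup>2 - 1 \<le> real N"
      using N_ge unfolding ceiling_le_iff A_def by simp
    then have "8 * lam\<^sup>2 * L1 * r0\<^sup>2 / (A * \<epsilon>\<^sup>2) \<le> real N + 1" by simp
    then have "8 * lam\<^sup>2 * L1 * r0\<^sup>2 \<le> (real N + 1) * (A * \<epsilon>\<^sup>2)"
      using steps(1) eps by (subst (asm) pos_divide_le_eq) auto
    then show ?thesis using lam L1 by (simp add: field_simps)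
  qed
  define R where "R = 6 * lam * \<sigma>\<^sup>2 / (L1 * A)"
  have noise: "2 * (3 * h1 * h2 + h2\<^sup>2) * (lam * \<sigma>\<^sup>2) \<le> A / (lam\<^sup>2 * L1) * R"
  proof -
    have "2 * (3 * h1 * h2 + h2\<^sup>2) * (lam * \<sigma>\<^sup>2) \<le> 6 / (lam\<^sup>2 * L1\<^sup>2) * (lam * \<sigma>\<^sup>2)"
      using lam by (intro mult_right_mono steps(5)) auto
    also have "\<dots> = A / (lam\<^sup>2 * L1) * R"
      using steps(1) lam L1 by (simp add: R_def power2_eq_square)
    finally show ?thesis .
  qed
  have R: "0 \<le> R" using lam L1 steps(1) by (simp add: R_def)
  have "2 * E.err \<le> A / (lam\<^sup>2 * L1) * (\<epsilon>\<^sup>2 / 8) + A / (lam\<^sup>2 * L1) * R"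
    using mus(2)[OF mu_le'] noise unfolding E.err_def \<eta>_def[symmetric] by (simp add: algebra_simps)
  also have "\<dots> = A / (lam\<^sup>2 * L1) * (\<epsilon>\<^sup>2 / 8 + R)" by (simp add: distrib_left)
  finally have err: "2 * E.err \<le> A / (lam\<^sup>2 * L1) * (\<epsilon>\<^sup>2 / 8 + R)" .
  have b2: "2 * S.smoothing_err \<le> \<epsilon>\<^sup>2 / 32"
    using mus(1)[OF mu_le'] by (simp add: err_eq)
  \<comment> \<open>The budget in units of \<open>\<epsilon>^2\<close>: \<open>1 / 4\<close> for the
    initial distance, \<open>1 / 8\<close> for the weak Minty defect and \<open>1 / 32\<close> for
    the distance to \<open>F\<close>, in total \<open>13 / 32\<close>. The sampling noise is
    \<open>R\<close>.\<close>
  have "c * ?T \<le> (real N + 1) * (A / (lam\<^sup>2 * L1) * (\<epsilon>\<^sup>2 / 4) + 2 * E.err + c * (2 * S.smoothing_err))"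
    using bound N by (simp add: algebra_simps)
  also have "\<dots> \<le> (real N + 1) * (A / (lam\<^sup>2 * L1) * (\<epsilon>\<^sup>2 / 4) + A / (lam\<^sup>2 * L1) * (\<epsilon>\<^sup>2 / 8 + R) + c * (\<epsilon>\<^sup>2 / 32))"
    using err b2 c_pos by (intro mult_left_mono add_mono order_refl) auto
  \<comment> \<open>Raising \<open>A / (lam^2 * L1)\<close> to \<open>c\<close> makes
    \<open>c\<close> a common factor, which then cancels.\<close>
  also have "\<dots> \<le> (real N + 1) * (c * (\<epsilon>\<^sup>2 / 4) + c * (\<epsilon>\<^sup>2 / 8 + R) + c * (\<epsilon>\<^sup>2 / 32))"
    using c_ge R by (intro mult_left_mono add_mono mult_right_mono) auto
  also have "\<dots> = c * ((real N + 1) * (\<epsilon>\<^sup>2 / 4 + \<epsilon>\<^sup>2 / 8 + \<epsilon>\<^sup>2 / 32 + R))"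
    by (simp add: algebra_simps)
  finally have "?T \<le> (real N + 1) * (\<epsilon>\<^sup>2 / 4 + \<epsilon>\<^sup>2 / 8 + \<epsilon>\<^sup>2 / 32 + R)"
    using c_pos by (rule mult_left_le_imp_le)
  also have "\<dots> \<le> (real N + 1) * (\<epsilon>\<^sup>2 + R)"
    by (intro mult_left_mono) auto
  finally have "?T / (real N + 1) \<le> \<epsilon>\<^sup>2 + R"
    by (simp add: pos_divide_le_eq mult.commute)
  moreover have "R = 6 * lam * \<sigma>\<^sup>2 / (lam\<^sup>2 * L1\<^sup>2 * h2\<^sup>2 - 2 * \<rho> * L1)"
    by (simp add: R_def A_def algebra_simps power2_eq_square)
  ultimately show ?thesis by (simp add: atLeast0AtMost)
qed

end
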